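(* Let $\rho$ be a critical radius function on $\mathbb{R}^d$ and let $T$ be a linear operator with associated kernel $K$. Suppose that for some $s>1$ and $\delta>0$, $K$ satisfies the following condition: for each $N>0$ there exists $C_N$ such that $$\left(\int_{R<|x_0-x|<2R}|K(x,y)|^s\,dx\right)^{1/s}\le C_N R^{-d/s'}\left(1+\frac{\rho(x_0)}{R}\right)^{-\delta}\left(1+\frac{R}{\rho(x_0)}\right)^{-N}$$ whenever $|y-x_0|<R/2$. Then, for any $\theta\ge0$ and any weight $w$, there exists $C_\theta$ such that $T$ satisfies $$\int|Tf|^p\,w\le C_\theta\int|f|^p\,M_r^\theta w\qquad\text{for }1\le p<s,\ r=(s/p)',$$ and its adjoint $T^\star$ satisfies $$\int|T^\star f|^p\,w\le C_\theta\int|f|^p\,M^\theta w\qquad\text{for }s'<p<\infty.$$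
   Context: For an exponent $t$, $t'$ is the conjugate exponent. A weight is a function $w\ge0$ in $L^1_{\mathrm{loc}}(\mathbb{R}^d)$. $C_\theta$ denotes a constant that may depend on $\theta$ but not on $f$ or $w$. A critical radius function is a function $\rho:\mathbb{R}^d\to(0,\infty)$ for which there are constants $C_0$ and $N_0\ge1$ such that for all $x,y$ $$C_0^{-1}\rho(x)\left(1+\tfrac{|x-y|}{\rho(x)}\right)^{-N_0}\le\rho(y)\le C_0\,\rho(x)\left(1+\tfrac{|x-y|}{\rho(x)}\right)^{\frac{N_0}{N_0+1}}.$$ For $\theta\ge0$ and $1\le r<\infty$, $$M_r^\theta w(x)=\sup_{B(x_0,r_0)\ni x}\left(1+\frac{r_0}{\rho(x_0)}\right)^{-\theta}\left(\frac{1}{|B(x_0,r_0)|}\int_{B(x_0,r_0)}w^r\right)^{1/r},\qquad M^\theta=M_1^\theta.$$ *)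

theory Defs
  imports "HOL-Analysis.Analysis"
begin

definition conj_exp :: "real \<Rightarrow> real" where
  "conj_exp t = t / (t - 1)"

text \<open>Real powers of extended nonnegative reals; only used with a positive exponent, so that
  infinity is sent to infinity.\<close>

definition ennreal_powr :: "ennreal \<Rightarrow> real \<Rightarrow> ennreal" where
  "ennreal_powr x a = (if x = \<infinity> then \<infinity> else ennreal (enn2real x powr a))"

definition locally_integrable :: "('a::euclidean_space \<Rightarrow> 'b::euclidean_space) \<Rightarrow> bool" where
  "locally_integrable f \<longleftrightarrow>
     f \<in> borel_measurable borel \<and> (\<forall>S. compact S \<longrightarrow> set_integrable lborel S f)"

definition weight :: "('a::euclidean_space \<Rightarrow> real) \<Rightarrow> bool" where
  "weight w \<longleftrightarrow> (\<forall>x. 0 \<le> w x) \<and> locally_integrable w"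

definition critical_radius_function :: "('a::euclidean_space \<Rightarrow> real) \<Rightarrow> bool" where
  "critical_radius_function \<rho> \<longleftrightarrow>
     (\<forall>x. 0 < \<rho> x) \<and>
     (\<exists>C0 N0. 1 \<le> N0 \<and>
        (\<forall>x y. inverse C0 * \<rho> x * (1 + dist x y / \<rho> x) powr (- N0) \<le> \<rho> y \<and>
               \<rho> y \<le> C0 * \<rho> x * (1 + dist x y / \<rho> x) powr (N0 / (N0 + 1))))"

text \<open>The maximal function takes values in \<open>[0,\<infinity>]\<close>; an average of \<open>w\<^sup>r\<close> is infinite when
  \<open>w\<^sup>r\<close> is not integrable on the ball.\<close>

definition maximal_function ::
  "('a::euclidean_space \<Rightarrow> real) \<Rightarrow> real \<Rightarrow> real \<Rightarrow> ('a \<Rightarrow> real) \<Rightarrow> 'a \<Rightarrow> ennreal" where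
  "maximal_function \<rho> \<theta> r w x =
     (SUP (x0, r0) \<in> {(x0, r0). 0 < r0 \<and> x \<in> ball x0 r0}.
        ennreal ((1 + r0 / \<rho> x0) powr (- \<theta>)) *
        ennreal_powr
          ((\<integral>\<^sup>+y\<in>ball x0 r0. ennreal (w y powr r) \<partial>lborel) / emeasure lborel (ball x0 r0))
          (1 / r))"

text \<open>The natural domain of the integral operator with kernel \<open>K\<close>: the functions for which
  the defining integral converges absolutely at almost every point.\<close>

definition kernel_domain :: "('a::euclidean_space \<Rightarrow> 'a \<Rightarrow> complex) \<Rightarrow> ('a \<Rightarrow> complex) set" where
  "kernel_domain K =
     {f \<in> borel_measurable borel. AE x in lborel. integrable lborel (\<lambda>y. K x y * f y)}"

text \<open>Functions are identified when equal almost everywhere, hence the almost everywhere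
  quantifiers. There is no principal value and no restriction to points outside the support
  of \<open>f\<close>: otherwise multiplication by an arbitrary function would have kernel 0.\<close>

definition linear_operator_with_kernel ::
  "(('a::euclidean_space \<Rightarrow> complex) \<Rightarrow> 'a \<Rightarrow> complex) \<Rightarrow> ('a \<Rightarrow> 'a \<Rightarrow> complex) \<Rightarrow> bool" where
  "linear_operator_with_kernel T K \<longleftrightarrow>
     (\<lambda>(x, y). K x y) \<in> borel_measurable (borel \<Otimes>\<^sub>M borel) \<and>
     (\<forall>f\<in>kernel_domain K. T f \<in> borel_measurable borel) \<and>
     (\<forall>f\<in>kernel_domain K. \<forall>g\<in>kernel_domain K. \<forall>a b.
        AE x in lborel. T (\<lambda>z. a * f z + b * g z) x = a * T f x + b * T g x) \<and>
     (\<forall>f\<in>kernel_domain K. AE x in lborel. T f x = (\<integral>y. K x y * f y \<partial>lborel))"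

definition test_functions :: "('a::euclidean_space \<Rightarrow> complex) set" where
  "test_functions =
     {\<phi> \<in> borel_measurable borel. bounded (range \<phi>) \<and> bounded {x. \<phi> x \<noteq> 0}}"

text \<open>\<open>adjoint_pair T g h\<close> says that \<open>g\<close> is in the domain of the adjoint of \<open>T\<close>, with value \<open>h\<close>
  there, with respect to the pairing of \<open>f\<close> and \<open>g\<close> given by the integral of \<open>f\<close> times the
  conjugate of \<open>g\<close>. Such an \<open>h\<close> is unique up to null sets.\<close>

definition adjoint_pair ::
  "(('a::euclidean_space \<Rightarrow> complex) \<Rightarrow> 'a \<Rightarrow> complex) \<Rightarrow> ('a \<Rightarrow> complex) \<Rightarrow> ('a \<Rightarrow> complex) \<Rightarrow> bool" where
  "adjoint_pair T g h \<longleftrightarrow>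
     g \<in> borel_measurable borel \<and> locally_integrable h \<and>
     (\<forall>\<phi>\<in>test_functions.
        integrable lborel (\<lambda>x. T \<phi> x * cnj (g x)) \<and>
        (\<integral>x. T \<phi> x * cnj (g x) \<partial>lborel) = (\<integral>x. \<phi> x * cnj (h x) \<partial>lborel))"

definition adjoint_domain ::
  "(('a::euclidean_space \<Rightarrow> complex) \<Rightarrow> 'a \<Rightarrow> complex) \<Rightarrow> ('a \<Rightarrow> complex) set" where
  "adjoint_domain T = {g. \<exists>h. adjoint_pair T g h}"

definition is_adjoint ::
  "(('a::euclidean_space \<Rightarrow> complex) \<Rightarrow> 'a \<Rightarrow> complex) \<Rightarrow> (('a \<Rightarrow> complex) \<Rightarrow> 'a \<Rightarrow> complex) \<Rightarrow> bool" where
  "is_adjoint T Tstar \<longleftrightarrow> (\<forall>g\<in>adjoint_domain T. adjoint_pair T g (Tstar g))"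

end

theory Submission
  imports Defs
begin

text \<open>Write \<open>m(a,b,t)\<close> for \<open>decay a b t = t^a (1 + t)^(-a-b)\<close> and
  \<open>\<psi>(a,b,x,y) = \<bar>x - y\<bar>^(-d) m(a, b, \<bar>x - y\<bar> / \<rho> x)\<close>. Taken with \<open>x0 = y\<close>, the kernel condition reads
  \<open>C R^(-d/s') m(\<delta>, N, R / \<rho> y)\<close>. Summing over annuli, the integral of \<open>\<psi>(a,b,x,y) w(y)\<close> in \<open>y\<close> is at most
  \<open>C M\<^sup>\<theta> w(x)\<close> for \<open>b > \<theta>\<close>, and in particular is bounded for \<open>w = 1\<close>. The growth condition on \<open>\<rho>\<close> gives
  \<open>\<psi>(a,b',y,x) \<le> C \<psi>(a,b,x,y)\<close> for large \<open>b'\<close>. Hoelder's inequality on annuli around \<open>y\<close>, where the kernel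
  condition and the averages of \<open>w^r\<close> enter, bounds the integral of \<open>\<bar>K(x,y)\<bar>^p \<psi>(\<delta>,b',y,x)^(1-p) w(x)\<close>
  in \<open>x\<close> by \<open>C M\<^sub>r\<^sup>\<theta> w(y)\<close>, uniformly in \<open>p\<close>.

  For \<open>T\<close>, Jensen's inequality with respect to \<open>\<psi>(x,y) dy\<close> bounds \<open>\<bar>T f(x)\<bar>^p\<close> by the integral of
  \<open>\<bar>K(x,y)\<bar>^p \<bar>f(y)\<bar>^p \<psi>(x,y)^(1-p)\<close>, and Tonelli's theorem concludes. For the adjoint, Hoelder's inequality
  separates \<open>\<bar>K(x,y)\<bar>^p' \<psi>(y,x)^(1-p')\<close>, whose integral is bounded by the same estimate with \<open>w = 1\<close>
  because \<open>p' < s\<close>, from \<open>\<bar>f(x)\<bar>^p \<psi>(y,x)\<close>.\<close>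

subsection \<open>Radial kernels\<close>

text \<open>A critical radius function need not be measurable, but it is comparable to a lower
  semicontinuous function.\<close>

lemma critical_radius_majorant:
  fixes \<rho> :: "'a::euclidean_space \<Rightarrow> real"
  assumes "critical_radius_function \<rho>"
  obtains \<sigma> L where "\<sigma> \<in> borel_measurable borel" "1 \<le> L"
    "\<And>x. \<rho> x \<le> \<sigma> x" "\<And>x. \<sigma> x \<le> L * \<rho> x"
proof -
  from assms obtain C0 N0 where pos: "\<And>x. 0 < \<rho> x" and N0: "1 \<le> N0"
    and lo: "\<And>x y. inverse C0 * \<rho> x * (1 + dist x y / \<rho> x) powr (- N0) \<le> \<rho> y"
    and hi: "\<And>x y. \<rho> y \<le> C0 * \<rho> x * (1 + dist x y / \<rho> x) powr (N0 / (N0 + 1))"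
    unfolding critical_radius_function_def by blast
  have C0: "1 \<le> C0"
    using hi[of 0 0] pos[of 0] by simp
  define L where "L = C0 * 2 powr N0"
  \<comment> \<open>Take the supremum of \<rho> over all critical balls, of centre y and radius
    \<rho> y, that contain x. Superlevel sets of this supremum are unions of balls, hence
    open.\<close>
  define S where "S x = {\<rho> y | y. dist y x < \<rho> y}" for x
  define \<sigma> where "\<sigma> x = Sup (S x)" for x
  \<comment> \<open>Inside a critical ball the ratio of the distance to \<rho> y is below 1, so the
    lower growth bound loses at most the factor \<open>2 powr N0\<close>.\<close>
  have le: "\<rho> y \<le> L * \<rho> x" if "dist y x < \<rho> y" for x y
  proof -
    have "2 powr (- N0) \<le> (1 + dist y x / \<rho> y) powr (- N0)"
      using that pos[of y] N0 by (intro powr_mono2') (auto simp: add_pos_nonneg)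
    then have "inverse C0 * \<rho> y * 2 powr (- N0) \<le> inverse C0 * \<rho> y * (1 + dist y x / \<rho> y) powr (- N0)"
      using C0 pos[of y] by (intro mult_left_mono) (auto intro: less_imp_le)
    also have "\<dots> \<le> \<rho> x"
      by (rule lo)
    finally show ?thesis
      using C0 by (simp add: L_def powr_minus field_simps)
  qed
  have in_S: "\<rho> x \<in> S x" for x
    using pos[of x] by (auto simp: S_def)
  have bdd: "bdd_above (S x)" for x
    using le by (intro bdd_aboveI[of _ "L * \<rho> x"]) (auto simp: S_def)
  show thesis
  proof
    show "1 \<le> L"
      using C0 N0 ge_one_powr_ge_zero[of 2 N0] mult_mono[of 1 C0 1 "2 powr N0"] by (simp add: L_def)
    show "\<rho> x \<le> \<sigma> x" for x
      unfolding \<sigma>_def by (intro cSup_upper in_S bdd)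
    show "\<sigma> x \<le> L * \<rho> x" for x
      unfolding \<sigma>_def using in_S[of x] by (intro cSup_least) (auto simp: S_def intro: le)
    have "{x. c < \<sigma> x} = (\<Union>y\<in>{y. c < \<rho> y}. ball y (\<rho> y))" for c
      using in_S bdd less_cSup_iff[OF _ bdd] by (fastforce simp: \<sigma>_def S_def)
    then have "open {x. c < \<sigma> x}" for c
      by auto
    then show "\<sigma> \<in> borel_measurable borel"
      by (intro borel_measurableI_greater) auto
  qed
qed

text \<open>Of order t^a near 0 and t^(-b) near infinity: a and b are independent rates, and both
  must be positive for sums over geometrically spaced scales to converge.\<close>

definition decay :: "real \<Rightarrow> real \<Rightarrow> real \<Rightarrow> real" where
  "decay a b t = t powr a * (1 + t) powr (- (a + b))"

text \<open>The scale is taken at the first argument, so the kernel is not symmetric. The decay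
  makes the critical power -d integrable both at x and at infinity. On the diagonal the value is 0,
  because \<open>0 powr c = 0\<close>.\<close>

definition radial_kernel :: "('a::euclidean_space \<Rightarrow> real) \<Rightarrow> real \<Rightarrow> real \<Rightarrow> 'a \<Rightarrow> 'a \<Rightarrow> real" where
  "radial_kernel \<sigma> a b x y = dist x y powr (- real DIM('a)) * decay a b (dist x y / \<sigma> x)"

text \<open>Let u and v be the distance divided by \<sigma> x and by \<sigma> y. The lower growth
  bound gives v \<le> D u (1 + u)^N0, which controls v^a; the upper one gives (1 + u)^(1/(N0+1))
  \<le> D (1 + v), which makes a large negative power of 1 + v small in terms of u.\<close>

lemma radial_kernel_swap:
  fixes \<rho> \<sigma> :: "'a::euclidean_space \<Rightarrow> real"
  assumes crit: "critical_radius_function \<rho>"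
    and L: "1 \<le> L" and \<sigma>: "\<And>x. \<rho> x \<le> \<sigma> x" "\<And>x. \<sigma> x \<le> L * \<rho> x"
    and a: "0 < a" and b: "0 < b"
  obtains b1 C where "0 < b1" "1 \<le> C"
    "\<And>x y. radial_kernel \<sigma> a b1 y x \<le> C * radial_kernel \<sigma> a b x y"
proof -
  from crit obtain C0 N0 where pos: "\<And>x. 0 < \<rho> x" and N0: "1 \<le> N0"
    and lo: "\<And>x y. inverse C0 * \<rho> x * (1 + dist x y / \<rho> x) powr (- N0) \<le> \<rho> y"
    and hi: "\<And>x y. \<rho> y \<le> C0 * \<rho> x * (1 + dist x y / \<rho> x) powr (N0 / (N0 + 1))"
    unfolding critical_radius_function_def by blast
  have C0: "1 \<le> C0"
    using hi[of 0 0] pos[of 0] by simp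
  define D where "D = L * C0 * L powr N0"
  \<comment> \<open>Solves (a + b1) / (N0 + 1) = a + b + a N0: the gain from \<open>v_ge\<close>
    then covers the loss (1 + u)^(a N0) from \<open>v_le\<close> and still leaves the exponent -(a +
    b).\<close>
  define b1 where "b1 = (N0 + 1) * (a + b + a * N0) - a"
  define C where "C = D powr (a + (a + b1))"
  have LN: "1 \<le> L powr N0"
    using L N0 by (simp add: ge_one_powr_ge_zero)
  have LC: "1 \<le> L * C0"
    using L C0 mult_mono[of 1 L 1 C0] by simp
  have D: "1 \<le> D" "L * C0 \<le> D"
    using LN LC mult_mono[of 1 "L * C0" 1 "L powr N0"] mult_left_mono[of 1 "L powr N0" "L * C0"]
    by (auto simp: D_def)
  have b1: "0 < b1"
  proof -
    have "1 * (a + b + a * N0) \<le> (N0 + 1) * (a + b + a * N0)"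
      using N0 a b by (intro mult_right_mono) auto
    moreover have "0 < a * N0" using a N0 by simp
    ultimately show ?thesis using b unfolding b1_def by (simp only: mult_1)
  qed
  show thesis
  proof
    show "0 < b1" by fact
    show "1 \<le> C"
      unfolding C_def using D a b1 by (intro ge_one_powr_ge_zero) auto
    fix x y :: 'a
    \<comment> \<open>The growth condition speaks of \<open>tx\<close> and \<open>ty\<close>, scaled
      by \<rho>; the kernels contain \<open>u\<close> and \<open>v\<close>, scaled by \<sigma>. The
      fact \<open>cmp\<close> passes between them at the cost of L.\<close>
    define u v tx ty where "u = dist x y / \<sigma> x" and "v = dist x y / \<sigma> y"
      and "tx = dist x y / \<rho> x" and "ty = dist x y / \<rho> y"
    have spos: "0 < \<sigma> z" for z
      using pos[of z] \<sigma>(1)[of z] by linarith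
    have nn: "0 \<le> u" "0 \<le> v" "0 \<le> tx" "0 \<le> ty"
      using spos pos by (auto simp: u_def v_def tx_def ty_def less_imp_le)
    have cmp: "dist x y / \<sigma> z \<le> dist x y / \<rho> z" "dist x y / \<rho> z \<le> L * (dist x y / \<sigma> z)" for z
    proof -
      show "dist x y / \<sigma> z \<le> dist x y / \<rho> z"
        using \<sigma>(1)[of z] pos[of z] spos[of z] by (intro divide_left_mono) auto
      have "dist x y * \<sigma> z \<le> dist x y * (L * \<rho> z)"
        using \<sigma>(2)[of z] by (intro mult_left_mono) auto
      then show "dist x y / \<rho> z \<le> L * (dist x y / \<sigma> z)"
        using pos[of z] spos[of z] by (simp add: field_simps)
    qed
    have tx1: "1 + tx \<le> L * (1 + u)"
      using cmp(2)[of x] L unfolding u_def tx_def by (simp add: algebra_simps)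
    have "v \<le> ty" unfolding v_def ty_def by (rule cmp(1))
    also have "ty \<le> C0 * tx * (1 + tx) powr N0"
    proof -
      have "\<rho> x \<le> C0 * \<rho> y * (1 + tx) powr N0"
      proof -
        have "0 < C0 * (1 + tx) powr N0"
          using C0 nn by simp
        moreover have "\<rho> x / (C0 * (1 + tx) powr N0) \<le> \<rho> y"
          using lo[of x y] by (simp add: tx_def powr_minus divide_inverse mult_ac)
        ultimately show ?thesis
          by (simp add: pos_divide_le_eq mult_ac)
      qed
      then have "dist x y * \<rho> x \<le> dist x y * (C0 * \<rho> y * (1 + tx) powr N0)"
        by (intro mult_left_mono) auto
      then show ?thesis
        using pos[of x] pos[of y] by (simp add: tx_def ty_def field_simps)
    qed
    also have "\<dots> \<le> C0 * (L * u) * (L * (1 + u)) powr N0"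
    proof (intro mult_mono mult_left_mono powr_mono2)
      show "tx \<le> L * u" using cmp(2)[of x] by (simp add: u_def tx_def)
      show "0 \<le> C0 * (L * u)" using nn L C0 by simp
    qed (use nn C0 L N0 tx1 in auto)
    also have "\<dots> = D * (u * (1 + u) powr N0)"
      using nn L by (simp add: D_def powr_mult)
    finally have v_le: "v \<le> D * (u * (1 + u) powr N0)" .
    \<comment> \<open>The exponent N0 / (N0 + 1) is below 1, so dividing by that power of 1 + tx
      leaves the positive power 1 / (N0 + 1). Hence a point far from x on the scale of x is also far
      on the scale of y.\<close>
    have "C0 * (1 + ty) \<ge> (1 + tx) powr (1 / (N0 + 1))"
    proof -
      have e: "(1 + tx) * (1 + tx) powr (- (N0 / (N0 + 1))) = (1 + tx) powr (1 / (N0 + 1))"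
        using nn N0 powr_add[of "1 + tx" 1 "- (N0 / (N0 + 1))"]
        by (simp add: field_simps)
      have "\<rho> y \<le> C0 * \<rho> x * (1 + tx) powr (N0 / (N0 + 1))"
        using hi[of y x] by (simp add: tx_def)
      then have "dist x y * \<rho> y \<le> dist x y * (C0 * \<rho> x * (1 + tx) powr (N0 / (N0 + 1)))"
        by (intro mult_left_mono) auto
      then have "tx \<le> C0 * ty * (1 + tx) powr (N0 / (N0 + 1))"
        using pos[of x] pos[of y] by (simp add: tx_def ty_def field_simps)
      then have "tx * (1 + tx) powr (- (N0 / (N0 + 1))) \<le> C0 * ty"
        using nn by (simp add: powr_minus field_simps)
      moreover have "(1 + tx) powr (- (N0 / (N0 + 1))) \<le> 1"
        using nn N0 powr_mono[of "- (N0 / (N0 + 1))" 0 "1 + tx"] by simp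
      ultimately have "(1 + tx) * (1 + tx) powr (- (N0 / (N0 + 1))) \<le> C0 * ty + C0"
        using C0 by (simp add: distrib_right)
      then show ?thesis unfolding e by (simp add: algebra_simps)
    qed
    moreover have "1 + ty \<le> L * (1 + v)"
      using cmp(2)[of y] L unfolding v_def ty_def by (simp add: algebra_simps)
    then have "C0 * (1 + ty) \<le> C0 * (L * (1 + v))"
      using C0 by (intro mult_left_mono) auto
    moreover have "C0 * (L * (1 + v)) \<le> D * (1 + v)"
      using D(2) nn mult_right_mono[of "L * C0" D "1 + v"] by (simp add: mult_ac)
    moreover have "(1 + u) powr (1 / (N0 + 1)) \<le> (1 + tx) powr (1 / (N0 + 1))"
      using cmp(1)[of x] nn N0 unfolding u_def tx_def by (intro powr_mono2) auto
    ultimately have v_ge: "(1 + u) powr (1 / (N0 + 1)) \<le> D * (1 + v)"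
      by linarith
    have "decay a b1 v \<le> C * decay a b u"
    proof -
      have 1: "v powr a \<le> D powr a * (u powr a * (1 + u) powr (a * N0))"
      proof -
        have "v powr a \<le> (D * (u * (1 + u) powr N0)) powr a"
          using v_le nn a by (intro powr_mono2) auto
        also have "\<dots> = D powr a * (u powr a * (1 + u) powr (a * N0))"
          using D nn by (simp add: powr_mult powr_powr mult.commute)
        finally show ?thesis .
      qed
      have 2: "(1 + v) powr (- (a + b1)) \<le> D powr (a + b1) * (1 + u) powr (- (a + b + a * N0))"
      proof -
        have e: "(1 / (N0 + 1)) * (a + b1) = a + b + a * N0"
          using N0 by (simp add: b1_def)
        have "((1 + u) powr (1 / (N0 + 1))) powr (a + b1) \<le> (D * (1 + v)) powr (a + b1)"
          using v_ge a b1 by (intro powr_mono2) auto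
        then have "(1 + u) powr (a + b + a * N0) \<le> D powr (a + b1) * (1 + v) powr (a + b1)"
          using D nn by (simp only: powr_powr e) (simp add: powr_mult)
        moreover have "0 < (1 + u) powr (a + b + a * N0)" "0 < (1 + v) powr (a + b1)"
          using nn by auto
        ultimately show ?thesis
          unfolding powr_minus by (simp add: divide_simps mult_ac)
      qed
      have "decay a b1 v \<le> (D powr a * (u powr a * (1 + u) powr (a * N0))) *
          (D powr (a + b1) * (1 + u) powr (- (a + b + a * N0)))"
        unfolding decay_def using 1 2 by (intro mult_mono) auto
      also have "\<dots> = C * (u powr a * ((1 + u) powr (a * N0) * (1 + u) powr (- (a + b + a * N0))))"
        unfolding C_def powr_add[of D a] by (simp only: mult_ac)
      also have "(1 + u) powr (a * N0) * (1 + u) powr (- (a + b + a * N0)) = (1 + u) powr (- (a + b))"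
        by (simp add: powr_add[symmetric])
      finally show ?thesis by (simp add: decay_def)
    qed
    then have "dist x y powr (- real DIM('a)) * decay a b1 v
        \<le> dist x y powr (- real DIM('a)) * (C * decay a b u)"
      by (intro mult_left_mono) auto
    then show "radial_kernel \<sigma> a b1 y x \<le> C * radial_kernel \<sigma> a b x y"
      by (simp add: radial_kernel_def u_def v_def dist_commute mult_ac)
  qed
qed

text \<open>Within an annulus the argument changes by a factor of at most 2. As one factor of
  \<open>decay\<close> increases and the other decreases, this bound pays only for the power t^a,
  and \<open>decay_lower\<close> only for the power of 1 + t.\<close>

lemma decay_upper:
  assumes "0 < a" "0 \<le> b" "0 < \<tau>" "\<tau> \<le> t" "t \<le> 2 * \<tau>"
  shows "decay a b t \<le> 2 powr a * decay a b \<tau>"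
proof -
  have "decay a b t \<le> (2 * \<tau>) powr a * (1 + \<tau>) powr (- (a + b))"
    unfolding decay_def using assms by (intro mult_mono powr_mono2 powr_mono2') auto
  also have "\<dots> = 2 powr a * decay a b \<tau>"
    using assms by (simp add: decay_def powr_mult)
  finally show ?thesis .
qed

lemma decay_lower:
  assumes "0 < a" "0 \<le> b" "0 < \<tau>" "\<tau> \<le> t" "t \<le> 2 * \<tau>"
  shows "decay a b \<tau> \<le> 2 powr (a + b) * decay a b t"
proof -
  have "decay a b \<tau> = 2 powr (a + b) * (\<tau> powr a * (2 * (1 + \<tau>)) powr (- (a + b)))"
  proof -
    have "2 powr (a + b) * (2 * (1 + \<tau>)) powr (- (a + b)) = (1 + \<tau>) powr (- (a + b))"
      using assms by (subst powr_mult) (auto simp: powr_add[symmetric] mult.assoc[symmetric])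
    then show ?thesis by (simp add: decay_def mult.left_commute[of _ "\<tau> powr a"])
  qed
  also have "\<dots> \<le> 2 powr (a + b) * decay a b t"
    unfolding decay_def using assms by (intro mult_left_mono mult_mono powr_mono2 powr_mono2') auto
  finally show ?thesis .
qed

text \<open>The maximal function controls averages only up to a factor (1 + t)^\<theta>; this
  identity shows that such a factor merely lowers the rate at infinity.\<close>

lemma decay_mult_growth:
  assumes "0 < t"
  shows "decay a b t * (1 + t) powr c = decay a (b - c) t"
proof -
  have "- (a + b) + c = - (a + (b - c))" by simp
  with assms show ?thesis by (simp only: decay_def mult.assoc powr_add[symmetric])
qed

lemma decay_mono:
  assumes "0 < t" "b \<le> c"
  shows "decay a c t \<le> decay a b t"
  unfolding decay_def using assms by (intro mult_left_mono powr_mono) auto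

lemma decay_pos: "0 < t \<Longrightarrow> 0 < decay a b t"
  by (simp add: decay_def)

subsection \<open>Hoelder's inequality\<close>

lemma ennreal_powr_ennreal [simp]: "0 \<le> x \<Longrightarrow> ennreal_powr (ennreal x) a = ennreal (x powr a)"
  by (simp add: ennreal_powr_def)

lemma ennreal_powr_mono:
  assumes "x \<le> y" "0 < a"
  shows "ennreal_powr x a \<le> ennreal_powr y a"
proof (cases y)
  case (real u)
  with assms obtain v where "x = ennreal v" "0 \<le> v" "v \<le> u"
    by (cases x) (auto simp: top_unique)
  with real assms show ?thesis
    by (auto intro!: ennreal_leI powr_mono2)
qed (simp add: ennreal_powr_def)

lemma ennreal_powr_cmult:
  assumes "0 < c"
  shows "ennreal_powr (ennreal c * x) a = ennreal (c powr a) * ennreal_powr x a"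
proof (cases x)
  case (real u)
  with assms show ?thesis
    by (simp add: ennreal_mult[symmetric] powr_mult)
next
  case top
  with assms show ?thesis
    by (simp add: ennreal_powr_def ennreal_mult_top)
qed

lemma ennreal_le_powr_inverse:
  assumes "ennreal_powr x (1 / s) \<le> ennreal D" "0 < s" "0 \<le> D"
  shows "x \<le> ennreal (D powr s)"
proof (cases x)
  case (real u)
  with assms have "u powr (1 / s) \<le> D" by simp
  then have "(u powr (1 / s)) powr s \<le> D powr s"
    using assms by (intro powr_mono2) auto
  with real assms show ?thesis
    by (auto simp: powr_powr intro!: ennreal_leI)
next
  case top
  with assms show ?thesis by (simp add: ennreal_powr_def top_unique)
qed

text \<open>In the limiting cases the junk value \<open>0 powr 0 = 0\<close> only helps.\<close>

lemma weighted_amgm: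
  fixes x y \<alpha> :: real
  assumes "0 \<le> x" "0 \<le> y" "0 < \<alpha>" "\<alpha> \<le> 1"
  shows "x powr \<alpha> * y powr (1 - \<alpha>) \<le> \<alpha> * x + (1 - \<alpha>) * y"
proof (cases "x = 0 \<or> y = 0")
  case False
  then show ?thesis
    using Youngs_inequality_0[of \<alpha> "1 - \<alpha>" x y] assms by simp
qed (use assms in auto)

lemma nn_integral_Holder_finite:
  assumes [measurable]: "F \<in> borel_measurable M" "G \<in> borel_measurable M"
    and nn: "\<And>x. 0 \<le> F x" "\<And>x. 0 \<le> G x" and \<alpha>: "0 < \<alpha>" "\<alpha> \<le> 1"
    and F: "(\<integral>\<^sup>+x. ennreal (F x) \<partial>M) \<le> ennreal A" and "0 < A"
    and G: "(\<integral>\<^sup>+x. ennreal (G x) \<partial>M) \<le> ennreal B" and "0 < B"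
  shows "(\<integral>\<^sup>+x. ennreal (F x powr \<alpha> * G x powr (1 - \<alpha>)) \<partial>M) \<le> ennreal (A powr \<alpha> * B powr (1 - \<alpha>))"
proof -
  define D where "D = A powr \<alpha> * B powr (1 - \<alpha>)"
  have D: "0 < D" using assms by (simp add: D_def)
  have "(\<integral>\<^sup>+x. ennreal (F x powr \<alpha> * G x powr (1 - \<alpha>)) \<partial>M)
      \<le> (\<integral>\<^sup>+x. ennreal (D * \<alpha> / A) * ennreal (F x) + ennreal (D * (1 - \<alpha>) / B) * ennreal (G x) \<partial>M)"
  proof (intro nn_integral_mono)
    fix x
    have "F x powr \<alpha> * G x powr (1 - \<alpha>) = D * ((F x / A) powr \<alpha> * (G x / B) powr (1 - \<alpha>))"
      using nn \<open>0 < A\<close> \<open>0 < B\<close> by (simp add: D_def powr_divide)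
    also have "\<dots> \<le> D * (\<alpha> * (F x / A) + (1 - \<alpha>) * (G x / B))"
      using nn \<alpha> D \<open>0 < A\<close> \<open>0 < B\<close> by (intro mult_left_mono weighted_amgm) auto
    also have "\<dots> = D * \<alpha> / A * F x + D * (1 - \<alpha>) / B * G x"
      by (simp add: algebra_simps)
    finally show "ennreal (F x powr \<alpha> * G x powr (1 - \<alpha>))
        \<le> ennreal (D * \<alpha> / A) * ennreal (F x) + ennreal (D * (1 - \<alpha>) / B) * ennreal (G x)"
      using nn \<alpha> D \<open>0 < A\<close> \<open>0 < B\<close>
      by (simp add: ennreal_mult[symmetric] ennreal_plus[symmetric] del: ennreal_plus)
  qed
  also have "\<dots> = ennreal (D * \<alpha> / A) * (\<integral>\<^sup>+x. ennreal (F x) \<partial>M)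
      + ennreal (D * (1 - \<alpha>) / B) * (\<integral>\<^sup>+x. ennreal (G x) \<partial>M)"
    by (simp add: nn_integral_add nn_integral_cmult)
  also have "\<dots> \<le> ennreal (D * \<alpha> / A) * ennreal A + ennreal (D * (1 - \<alpha>) / B) * ennreal B"
    by (intro add_mono mult_left_mono F G) auto
  also have "\<dots> = ennreal (D * \<alpha> / A * A + D * (1 - \<alpha>) / B * B)"
    using \<alpha> D \<open>0 < A\<close> \<open>0 < B\<close>
    by (simp add: ennreal_mult[symmetric] ennreal_plus[symmetric] del: ennreal_plus)
  also have "D * \<alpha> / A * A + D * (1 - \<alpha>) / B * B = D"
    using \<open>0 < A\<close> \<open>0 < B\<close> by (simp add: distrib_left[symmetric])
  finally show ?thesis by (simp add: D_def)
qed

text \<open>Normalising by the integral of F breaks down when it is 0 or infinite. In the first case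
  F vanishes almost everywhere; in the second the right-hand side is infinite because B is
  positive.\<close>

lemma nn_integral_Holder:
  assumes [measurable]: "F \<in> borel_measurable M" "G \<in> borel_measurable M"
    and nn: "\<And>x. 0 \<le> F x" "\<And>x. 0 \<le> G x" and \<alpha>: "0 < \<alpha>" "\<alpha> \<le> 1"
    and G: "(\<integral>\<^sup>+x. ennreal (G x) \<partial>M) \<le> ennreal B" and B: "0 < B"
  shows "(\<integral>\<^sup>+x. ennreal (F x powr \<alpha> * G x powr (1 - \<alpha>)) \<partial>M)
    \<le> ennreal_powr (\<integral>\<^sup>+x. ennreal (F x) \<partial>M) \<alpha> * ennreal (B powr (1 - \<alpha>))"
proof (cases "\<integral>\<^sup>+x. ennreal (F x) \<partial>M")
  case (real A)
  show ?thesis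
  proof (cases "A = 0")
    case True
    then have "AE x in M. F x = 0"
      using real nn by (simp add: nn_integral_0_iff_AE antisym)
    then have "(\<integral>\<^sup>+x. ennreal (F x powr \<alpha> * G x powr (1 - \<alpha>)) \<partial>M) = (\<integral>\<^sup>+x. 0 \<partial>M)"
      by (intro nn_integral_cong_AE) auto
    then show ?thesis by simp
  next
    case False
    with real have "0 < A" by simp
    with nn_integral_Holder_finite[of F M G \<alpha> A B] real assms show ?thesis
      by (simp add: ennreal_mult)
  qed
next
  case top
  then show ?thesis using B by (simp add: ennreal_powr_def ennreal_top_mult)
qed

subsection \<open>Annuli and averages\<close>

text \<open>Open on both sides, to agree with the region of integration in the kernel
  condition.\<close>

definition annulus :: "'a::euclidean_space \<Rightarrow> real \<Rightarrow> 'a set" where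
  "annulus y R = {x. R < dist y x \<and> dist y x < 2 * R}"

lemma annulus_measurable [measurable]: "annulus y R \<in> sets borel"
  unfolding annulus_def by measurable

text \<open>The ratio \<open>3/2\<close> makes consecutive open annuli overlap, so that no spheres are left out.\<close>

lemma annuli_cover:
  assumes "0 < \<rho>" "x \<noteq> y"
  shows "x \<in> (\<Union>n. annulus y (\<rho> * (3/2) powr real n)) \<union> (\<Union>n. annulus y (\<rho> * (3/2) powr (- real n)))"
proof -
  define t where "t = dist y x / \<rho>"
  have t: "0 < t" using assms by (simp add: t_def)
  \<comment> \<open>This rounding gives k < log t \<le> k + 1, strict on the left as the open
    annulus demands; on the right there is room because 3/2 < 2.\<close>
  define k where "k = \<lceil>log (3/2) t\<rceil> - 1"
  have "real_of_int k < log (3/2) t" "log (3/2) t \<le> real_of_int k + 1"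
    unfolding k_def by linarith+
  then have "(3/2) powr real_of_int k < t" "t \<le> (3/2) powr (real_of_int k + 1)"
    using t by (auto simp: less_log_iff log_le_iff)
  moreover have "(3/2::real) powr (real_of_int k + 1) < 2 * (3/2) powr real_of_int k"
    by (simp add: powr_add)
  ultimately have "(3/2) powr real_of_int k < t" "t < 2 * (3/2) powr real_of_int k"
    by linarith+
  then have "x \<in> annulus y (\<rho> * (3/2) powr real_of_int k)"
    using assms by (simp add: annulus_def t_def field_simps)
  moreover have "real_of_int k = real (nat k) \<or> real_of_int k = - real (nat (- k))"
    by linarith
  ultimately show ?thesis by (auto simp del: of_nat_nat)
qed

text \<open>The sum of two geometric series, of ratios (3/2)^(-b) and (3/2)^(-a), for the annuli
  outside and inside the critical scale.\<close>

definition annuli_const :: "real \<Rightarrow> real \<Rightarrow> real" where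
  "annuli_const a b = 1 / (1 - (3/2) powr (- b)) + 1 / (1 - (3/2) powr (- a))"

lemma annuli_const_pos: "0 < a \<Longrightarrow> 0 < b \<Longrightarrow> 0 < annuli_const a b"
  using powr_less_mono[of "-a" 0 "3/2::real"] powr_less_mono[of "-b" 0 "3/2::real"]
  by (simp add: annuli_const_def add_pos_pos)

text \<open>The annuli of radii \<rho> (3/2)^n and \<rho> (3/2)^(-n) miss only the null set {y}.
  Since \<open>decay a b t\<close> is at most t^(-b) and at most t^a, the two families of bounds are
  dominated by geometric series. The factor X may be infinite.\<close>

lemma nn_integral_le_annuli:
  fixes y :: "'a::euclidean_space"
  assumes a: "0 < a" and b: "0 < b"
    and G [measurable]: "G \<in> borel_measurable borel" and \<rho>: "0 < \<rho>"
    and bd: "\<And>R. 0 < R \<Longrightarrow> (\<integral>\<^sup>+x\<in>annulus y R. G x \<partial>lborel) \<le> ennreal (decay a b (R / \<rho>)) * X"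
  shows "(\<integral>\<^sup>+x. G x \<partial>lborel) \<le> ennreal (annuli_const a b) * X"
proof -
  define S where "S c = 1 / (1 - (3/2::real) powr (- c))" for c
  have S: "(\<lambda>n. (3/2) powr (- c * real n)) sums S c" "0 < S c" if "0 < c" for c
  proof -
    have "(3/2::real) powr (- c) < 1"
      using that powr_less_mono[of "-c" 0 "3/2::real"] by simp
    moreover from this have "(\<lambda>n. ((3/2) powr (- c)) ^ n) sums S c"
      unfolding S_def by (intro geometric_sums) simp
    moreover have "((3/2::real) powr (- c)) ^ n = (3/2) powr (- c * real n)" for n
      by (subst powr_power) (auto simp: mult.commute)
    ultimately show "0 < S c" "(\<lambda>n. (3/2) powr (- c * real n)) sums S c"
      by (simp_all add: S_def)
  qed
  \<comment> \<open>The annuli overlap, so the integral over their union is estimated by countable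
    subadditivity of the measure with density G.\<close>
  define M where "M = density lborel G"
  have em: "emeasure M A = (\<integral>\<^sup>+x\<in>A. G x \<partial>lborel)" if "A \<in> sets borel" for A
    using that by (simp add: M_def emeasure_density)
  have union: "emeasure M (\<Union>n. annulus y (\<rho> * r n)) \<le> ennreal (S c) * X"
    if r: "\<And>n. 0 < r n" "\<And>n. decay a b (r n) \<le> (3/2) powr (- c * real n)" and c: "0 < c"
    for r :: "nat \<Rightarrow> real" and c
  proof -
    have "emeasure M (\<Union>n. annulus y (\<rho> * r n)) \<le> (\<Sum>n. emeasure M (annulus y (\<rho> * r n)))"
      by (intro emeasure_subadditive_countably) (auto simp: M_def)
    also have "\<dots> \<le> (\<Sum>n. ennreal ((3/2) powr (- c * real n)) * X)"
    proof (intro suminf_le)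
      fix n
      have "emeasure M (annulus y (\<rho> * r n)) \<le> ennreal (decay a b (r n)) * X"
        using bd[of "\<rho> * r n"] r(1)[of n] \<rho> by (simp add: em)
      also have "\<dots> \<le> ennreal ((3/2) powr (- c * real n)) * X"
        by (intro mult_right_mono ennreal_leI r) auto
      finally show "emeasure M (annulus y (\<rho> * r n)) \<le> ennreal ((3/2) powr (- c * real n)) * X" .
    qed auto
    also have "\<dots> = ennreal (S c) * X"
      by (simp only: ennreal_suminf_multc suminf_ennreal_eq[OF powr_ge_zero S(1)[OF c]])
    finally show ?thesis .
  qed
  define U V where "U = (\<Union>n. annulus y (\<rho> * (3/2) powr real n))"
    and "V = (\<Union>n. annulus y (\<rho> * (3/2) powr (- real n)))"
  have [measurable]: "U \<in> sets borel" "V \<in> sets borel"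
    unfolding U_def V_def by (intro sets.countable_nat_UN image_subsetI annulus_measurable)+
  have "(\<integral>\<^sup>+x. G x \<partial>lborel) \<le> (\<integral>\<^sup>+x. G x * indicator U x + G x * indicator V x \<partial>lborel)"
  proof (intro nn_integral_mono_AE eventually_mono[OF AE_lborel_singleton[of y]])
    fix x assume "x \<noteq> y"
    with annuli_cover[OF \<rho>] have "x \<in> U \<union> V" unfolding U_def V_def .
    then show "G x \<le> G x * indicator U x + G x * indicator V x"
      by (auto simp: indicator_def)
  qed
  also have "\<dots> = emeasure M U + emeasure M V"
    by (simp add: em nn_integral_add)
  also have "\<dots> \<le> ennreal (S b) * X + ennreal (S a) * X"
    unfolding U_def V_def
  proof (intro add_mono union a b)
    fix n
    have "decay a b t \<le> t powr (- b)" if "0 < t" for t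
    proof -
      have "decay a b t \<le> t powr a * t powr (- (a + b))"
        unfolding decay_def using that a b by (intro mult_left_mono powr_mono2') auto
      then show ?thesis using that by (simp add: powr_add[symmetric])
    qed
    from this[of "(3/2) powr real n"]
    show "decay a b ((3/2) powr real n) \<le> (3/2) powr (- b * real n)"
      by (simp add: powr_powr mult.commute)
    have "decay a b t \<le> t powr a" if "0 < t" for t
      unfolding decay_def using that a b powr_mono[of "- (a + b)" 0 "1 + t"]
      by (intro mult_left_le) auto
    from this[of "(3/2) powr (- real n)"]
    show "decay a b ((3/2) powr (- real n)) \<le> (3/2) powr (- a * real n)"
      by (simp add: powr_powr mult.commute)
  qed auto
  also have "\<dots> = ennreal (S b + S a) * X"
    using S a b by (simp add: distrib_right less_imp_le)
  finally show ?thesis by (simp only: annuli_const_def S_def)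
qed

text \<open>A single ball of the defining supremum, with its growth factor and volume moved to the
  other side; both are positive and finite, so this is legitimate even for infinite values.\<close>

lemma ball_average_le_maximal_function:
  assumes "0 < r0" "x \<in> ball x0 r0" "0 < \<rho> x0"
  shows "ennreal_powr (\<integral>\<^sup>+y\<in>ball x0 r0. ennreal (w y powr r) \<partial>lborel) (1 / r)
    \<le> ennreal ((1 + r0 / \<rho> x0) powr \<theta> * measure lborel (ball x0 r0) powr (1 / r)) * maximal_function \<rho> \<theta> r w x"
proof -
  let ?I = "\<integral>\<^sup>+y\<in>ball x0 r0. ennreal (w y powr r) \<partial>lborel"
  define c where "c = measure lborel (ball x0 r0)"
  define u where "u = (1 + r0 / \<rho> x0) powr \<theta>"
  have c: "0 < c"
    using assms by (simp add: c_def)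
  have "0 < 1 + r0 / \<rho> x0"
    using assms by (simp add: add_pos_pos)
  then have u: "0 < u" by (simp add: u_def)
  have "emeasure lborel (ball x0 r0) = ennreal c"
    using emeasure_lborel_ball_finite[of x0 r0] by (simp add: c_def emeasure_eq_ennreal_measure)
  then have "ennreal (inverse u) * ennreal_powr (?I / ennreal c) (1 / r) \<le> maximal_function \<rho> \<theta> r w x"
    using assms unfolding maximal_function_def
    by (intro SUP_upper2[of "(x0, r0)"]) (auto simp: u_def powr_minus)
  moreover have "ennreal_powr ?I (1 / r) = ennreal (c powr (1 / r)) * ennreal_powr (?I / ennreal c) (1 / r)"
  proof -
    have "ennreal c * (?I / ennreal c) = ?I"
      using c by (subst ennreal_times_divide, subst mult.commute, intro mult_divide_eq_ennreal) auto
    then show ?thesis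
      using ennreal_powr_cmult[OF c, of "?I / ennreal c" "1 / r"] by simp
  qed
  ultimately have "ennreal u * ennreal (c powr (1 / r)) * (ennreal (inverse u) * ennreal_powr (?I / ennreal c) (1 / r))
      \<le> ennreal u * ennreal (c powr (1 / r)) * maximal_function \<rho> \<theta> r w x"
    by (intro mult_left_mono) auto
  moreover have "ennreal u * ennreal (c powr (1 / r)) * (ennreal (inverse u) * ennreal_powr (?I / ennreal c) (1 / r))
      = (ennreal u * ennreal (inverse u)) * (ennreal (c powr (1 / r)) * ennreal_powr (?I / ennreal c) (1 / r))"
    by (simp only: mult_ac)
  moreover have "ennreal u * ennreal (inverse u) = 1"
    using u by (simp add: ennreal_mult[symmetric])
  ultimately show ?thesis
    using \<open>ennreal_powr ?I (1 / r) = _\<close> u by (simp add: ennreal_mult c_def u_def)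
qed

text \<open>Taking the weight 1 turns the weighted estimates below into unweighted ones:
  integrability of the radial kernel and uniform bounds on integrals of powers of K.\<close>

lemma maximal_function_one_le:
  fixes \<rho> :: "'a::euclidean_space \<Rightarrow> real"
  assumes "\<And>x. 0 < \<rho> x" "0 \<le> \<theta>"
  shows "maximal_function \<rho> \<theta> r (\<lambda>_. 1) x \<le> 1"
  unfolding maximal_function_def
proof (intro SUP_least, clarify)
  fix x0 :: 'a and r0 :: real
  assume r0: "0 < r0"
  have "emeasure lborel (ball x0 r0) \<noteq> 0" "emeasure lborel (ball x0 r0) \<noteq> \<infinity>"
    using r0 emeasure_lborel_ball_finite[of x0 r0]
      by (auto simp: emeasure_eq_ennreal_measure ennreal_eq_0_iff not_le)
  then have "(\<integral>\<^sup>+y\<in>ball x0 r0. ennreal (1 powr r) \<partial>lborel) / emeasure lborel (ball x0 r0) = ennreal 1"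
    by (simp add: ennreal_divide_self less_top)
  moreover have "(1 + r0 / \<rho> x0) powr (- \<theta>) \<le> 1"
  proof -
    have "0 < 1 + r0 / \<rho> x0" using assms r0 by (simp add: add_pos_pos)
    then show ?thesis
      using powr_mono[of "- \<theta>" 0 "1 + r0 / \<rho> x0"] assms r0 by (simp add: less_imp_le)
  qed
  ultimately show "ennreal ((1 + r0 / \<rho> x0) powr (- \<theta>)) *
       ennreal_powr ((\<integral>\<^sup>+y\<in>ball x0 r0. ennreal (1 powr r) \<partial>lborel) / emeasure lborel (ball x0 r0)) (1 / r) \<le> 1"
    by (simp del: ennreal_1 add: ennreal_1[symmetric] ennreal_mult[symmetric])
qed

text \<open>The annulus lies in the ball of radius 2 R about y. The constant is independent of r,
  which is what later makes the bound for T uniform in p.\<close>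

lemma annulus_average_le_maximal_function:
  fixes \<rho> \<sigma> :: "'a::euclidean_space \<Rightarrow> real"
  assumes \<rho>: "\<And>x. 0 < \<rho> x" and L: "1 \<le> L" and \<sigma>: "\<And>x. \<rho> x \<le> \<sigma> x" "\<And>x. \<sigma> x \<le> L * \<rho> x"
    and \<theta>: "0 \<le> \<theta>"
  obtains C where "1 \<le> C"
    "\<And>r w y R. 1 \<le> r \<Longrightarrow> 0 < R \<Longrightarrow>
      ennreal_powr (\<integral>\<^sup>+x\<in>annulus y R. ennreal (w x powr r) \<partial>lborel) (1 / r)
      \<le> ennreal (C * R powr (real DIM('a) / r) * (1 + R / \<sigma> y) powr \<theta>) * maximal_function \<rho> \<theta> r w y"
proof
  \<comment> \<open>The maximum with 1 ensures that the power 1 / r of the volume constant is at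
    most the constant itself. In C, the factor \<open>(2 * L) powr \<theta>\<close> pays for the
    doubled radius and for replacing \<rho> by \<sigma>.\<close>
  define V where "V = max 1 (measure lborel (ball (0::'a) 1))"
  define C where "C = (2 * L) powr \<theta> * 2 ^ DIM('a) * V"
  have V: "1 \<le> V" by (simp add: V_def)
  have "1 \<le> (2 * L) powr \<theta>"
    using L \<theta> by (intro ge_one_powr_ge_zero) auto
  then have "1 * 1 * 1 \<le> (2 * L) powr \<theta> * 2 ^ DIM('a) * V"
    using V by (intro mult_mono) auto
  then show "1 \<le> C" by (simp add: C_def)
  fix r R :: real and w and y :: 'a
  assume r: "1 \<le> r" and R: "0 < R"
  have spos: "0 < \<sigma> y" using \<rho>[of y] \<sigma>(1)[of y] by linarith
  have "ennreal_powr (\<integral>\<^sup>+x\<in>annulus y R. ennreal (w x powr r) \<partial>lborel) (1 / r)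
      \<le> ennreal_powr (\<integral>\<^sup>+x\<in>ball y (2 * R). ennreal (w x powr r) \<partial>lborel) (1 / r)"
    using r by (intro ennreal_powr_mono nn_integral_mono) (auto simp: annulus_def indicator_def)
  also have "\<dots> \<le> ennreal ((1 + 2 * R / \<rho> y) powr \<theta> * measure lborel (ball y (2 * R)) powr (1 / r)) *
      maximal_function \<rho> \<theta> r w y"
    using R \<rho> by (intro ball_average_le_maximal_function) auto
  also have "\<dots> \<le> ennreal (C * R powr (real DIM('a) / r) * (1 + R / \<sigma> y) powr \<theta>) *
      maximal_function \<rho> \<theta> r w y"
  proof (intro mult_right_mono ennreal_leI)
    have "R / \<rho> y \<le> L * (R / \<sigma> y)"
      using \<sigma>(2)[of y] \<rho>[of y] spos R by (simp add: field_simps)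
    then have "1 + 2 * (R / \<rho> y) \<le> 2 * L + 2 * (L * (R / \<sigma> y))"
      using L by linarith
    then have "1 + 2 * R / \<rho> y \<le> 2 * L * (1 + R / \<sigma> y)"
      by (simp add: algebra_simps)
    then have "(1 + 2 * R / \<rho> y) powr \<theta> \<le> (2 * L * (1 + R / \<sigma> y)) powr \<theta>"
      using \<theta> R \<rho>[of y] by (intro powr_mono2) (auto simp: add_nonneg_nonneg)
    also have "\<dots> = (2 * L) powr \<theta> * (1 + R / \<sigma> y) powr \<theta>"
      using L R spos by (simp add: powr_mult)
    finally have 1: "(1 + 2 * R / \<rho> y) powr \<theta> \<le> (2 * L) powr \<theta> * (1 + R / \<sigma> y) powr \<theta>" .
    have "measure lborel (ball y (2 * R)) \<le> (2 ^ DIM('a) * V) * R ^ DIM('a)"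
      using R by (subst content_ball_conv_unit_ball) (auto simp: V_def power_mult_distrib)
    then have "measure lborel (ball y (2 * R)) powr (1 / r) \<le> ((2 ^ DIM('a) * V) * R ^ DIM('a)) powr (1 / r)"
      using r by (intro powr_mono2) auto
    also have "\<dots> = (2 ^ DIM('a) * V) powr (1 / r) * R powr (real DIM('a) / r)"
      using R V by (simp add: powr_mult powr_realpow[symmetric] powr_powr del: of_nat_Suc)
    also have "(2 ^ DIM('a) * V) powr (1 / r) \<le> (2 ^ DIM('a) * V) powr 1"
      using V r mult_mono[of 1 "2 ^ DIM('a)" 1 V] by (intro powr_mono) auto
    also have "\<dots> = 2 ^ DIM('a) * V" using V by simp
    finally have 2: "measure lborel (ball y (2 * R)) powr (1 / r) \<le> 2 ^ DIM('a) * V * R powr (real DIM('a) / r)"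
      by (simp add: mult_right_mono)
    have "(1 + 2 * R / \<rho> y) powr \<theta> * measure lborel (ball y (2 * R)) powr (1 / r)
        \<le> ((2 * L) powr \<theta> * (1 + R / \<sigma> y) powr \<theta>) * (2 ^ DIM('a) * V * R powr (real DIM('a) / r))"
      using 1 2 by (intro mult_mono) auto
    also have "\<dots> = C * R powr (real DIM('a) / r) * (1 + R / \<sigma> y) powr \<theta>"
      by (simp add: C_def mult_ac)
    finally show "(1 + 2 * R / \<rho> y) powr \<theta> * measure lborel (ball y (2 * R)) powr (1 / r)
        \<le> C * R powr (real DIM('a) / r) * (1 + R / \<sigma> y) powr \<theta>" .
  qed auto
  finally show "ennreal_powr (\<integral>\<^sup>+x\<in>annulus y R. ennreal (w x powr r) \<partial>lborel) (1 / r)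
      \<le> ennreal (C * R powr (real DIM('a) / r) * (1 + R / \<sigma> y) powr \<theta>) * maximal_function \<rho> \<theta> r w y" .
qed

section \<open>Radial kernels and the kernel K on annuli\<close>

lemma radial_kernel_measurable [measurable]:
  assumes [measurable]: "\<sigma> \<in> borel_measurable borel"
  shows "(\<lambda>(x, y). radial_kernel \<sigma> a b x y) \<in> borel_measurable (borel \<Otimes>\<^sub>M borel)"
  unfolding radial_kernel_def decay_def by measurable

lemma radial_kernel_measurable_snd [measurable]:
  "radial_kernel \<sigma> a b x \<in> borel_measurable borel"
  unfolding radial_kernel_def decay_def by measurable

lemma radial_kernel_nonneg: "0 \<le> radial_kernel \<sigma> a b x y"
  by (simp add: radial_kernel_def decay_def)

lemma radial_kernel_pos: "0 < \<sigma> x \<Longrightarrow> x \<noteq> y \<Longrightarrow> 0 < radial_kernel \<sigma> a b x y"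
  by (simp add: radial_kernel_def decay_pos)

text \<open>All quantities are comparable to their values at distance R. The upper bound serves for
  averaging a weight; the lower bound serves where the radial kernel occurs with the nonpositive
  exponent 1 - p.\<close>

lemma radial_kernel_annulus:
  fixes \<sigma> :: "'a::euclidean_space \<Rightarrow> real"
  assumes "0 < a" "0 \<le> b" "0 < R" "0 < \<sigma> x" and y: "y \<in> annulus x R"
  shows "radial_kernel \<sigma> a b x y \<le> 2 powr a * (R powr (- real DIM('a)) * decay a b (R / \<sigma> x))"
    and "R powr (- real DIM('a)) * decay a b (R / \<sigma> x)
      \<le> 2 powr (real DIM('a) + a + b) * radial_kernel \<sigma> a b x y"
proof -
  have y': "R \<le> dist x y" "dist x y \<le> 2 * R" "0 < dist x y"
    using y \<open>0 < R\<close> by (auto simp: annulus_def simp del: zero_less_dist_iff)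
  then have t: "0 < R / \<sigma> x" "R / \<sigma> x \<le> dist x y / \<sigma> x" "dist x y / \<sigma> x \<le> 2 * (R / \<sigma> x)"
    using assms by (auto simp: divide_right_mono field_simps)
  have "radial_kernel \<sigma> a b x y \<le> R powr (- real DIM('a)) * (2 powr a * decay a b (R / \<sigma> x))"
    unfolding radial_kernel_def using y' assms t
    by (intro mult_mono powr_mono2' decay_upper) (auto simp: decay_def)
  then show "radial_kernel \<sigma> a b x y \<le> 2 powr a * (R powr (- real DIM('a)) * decay a b (R / \<sigma> x))"
    by (simp add: mult_ac)
  have "R powr (- real DIM('a)) = 2 powr real DIM('a) * (2 * R) powr (- real DIM('a))"
    using \<open>0 < R\<close> by (simp add: powr_mult powr_minus)
  also have "\<dots> \<le> 2 powr real DIM('a) * dist x y powr (- real DIM('a))"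
    using y' by (intro mult_left_mono powr_mono2') auto
  finally have "R powr (- real DIM('a)) * decay a b (R / \<sigma> x) \<le>
     (2 powr real DIM('a) * dist x y powr (- real DIM('a))) * (2 powr (a + b) * decay a b (dist x y / \<sigma> x))"
    using assms t by (intro mult_mono decay_lower) (auto simp: decay_def)
  then show "R powr (- real DIM('a)) * decay a b (R / \<sigma> x)
      \<le> 2 powr (real DIM('a) + a + b) * radial_kernel \<sigma> a b x y"
    unfolding radial_kernel_def powr_add by (simp only: mult_ac)
qed

text \<open>An annulus contributes R^(-d) \<open>decay a b (R / \<sigma> x)\<close> times an
  integral of w of order R^d (1 + R / \<sigma> x)^\<theta> times the maximal function. The powers of
  R cancel and the growth lowers the rate b to b - \<theta>, which is still positive, so the annuli
  can be summed.\<close>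

lemma radial_kernel_average:
  fixes \<rho> \<sigma> :: "'a::euclidean_space \<Rightarrow> real"
  assumes \<rho>: "\<And>x. 0 < \<rho> x" and L: "1 \<le> L" and \<sigma>: "\<And>x. \<rho> x \<le> \<sigma> x" "\<And>x. \<sigma> x \<le> L * \<rho> x"
    and \<theta>: "0 \<le> \<theta>" and a: "0 < a" and b: "\<theta> < b"
  obtains C where "0 < C"
    "\<And>w x. w \<in> borel_measurable borel \<Longrightarrow> \<forall>y. 0 \<le> w y \<Longrightarrow>
      (\<integral>\<^sup>+y. ennreal (radial_kernel \<sigma> a b x y * w y) \<partial>lborel) \<le> ennreal C * maximal_function \<rho> \<theta> 1 w x"
proof -
  obtain A where A: "1 \<le> A" and avg: "\<And>r w y R. 1 \<le> r \<Longrightarrow> 0 < R \<Longrightarrow>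
      ennreal_powr (\<integral>\<^sup>+x\<in>annulus y R. ennreal (w x powr r) \<partial>lborel) (1 / r)
      \<le> ennreal (A * R powr (real DIM('a) / r) * (1 + R / \<sigma> y) powr \<theta>) * maximal_function \<rho> \<theta> r w y"
    by (rule annulus_average_le_maximal_function[OF \<rho> L \<sigma> \<theta>]) (rule that)
  define C where "C = annuli_const a (b - \<theta>)"
  have C: "0 < C" using a b by (simp add: C_def annuli_const_pos)
  note annuli = nn_integral_le_annuli[OF a, of "b - \<theta>", folded C_def]
  show thesis
  proof
    show "0 < C * (2 powr a * A)" using C A by simp
    fix w :: "'a \<Rightarrow> real" and x :: 'a
    assume w [measurable]: "w \<in> borel_measurable borel" and "\<forall>y. 0 \<le> w y"
    then have w0: "\<And>y. 0 \<le> w y" by simp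
    let ?M = "maximal_function \<rho> \<theta> 1 w x"
    have spos: "0 < \<sigma> x" using \<rho>[of x] \<sigma>(1)[of x] by linarith
    have "(\<integral>\<^sup>+y. ennreal (radial_kernel \<sigma> a b x y * w y) \<partial>lborel) \<le> ennreal C * (ennreal (2 powr a * A) * ?M)"
    proof (rule annuli[OF _ _ spos, of _ x])
      fix R :: real assume R: "0 < R"
      define c where "c = 2 powr a * (R powr (- real DIM('a)) * decay a b (R / \<sigma> x))"
      have c: "0 \<le> c" by (simp add: c_def decay_def)
      have "ennreal (radial_kernel \<sigma> a b x y * w y) \<le> ennreal c * ennreal (w y)" if "y \<in> annulus x R" for y
        using radial_kernel_annulus(1)[of a b R \<sigma> x y] that a b \<theta> spos R w0[of y] c
        by (auto simp: c_def ennreal_mult[symmetric] intro!: ennreal_leI mult_right_mono)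
      then have "(\<integral>\<^sup>+y\<in>annulus x R. ennreal (radial_kernel \<sigma> a b x y * w y) \<partial>lborel)
          \<le> (\<integral>\<^sup>+y. ennreal c * (ennreal (w y) * indicator (annulus x R) y) \<partial>lborel)"
        by (intro nn_integral_mono) (auto simp: indicator_def)
      also have "\<dots> = ennreal c * (\<integral>\<^sup>+y\<in>annulus x R. ennreal (w y) \<partial>lborel)"
        by (subst nn_integral_cmult) auto
      also have "(\<integral>\<^sup>+y\<in>annulus x R. ennreal (w y) \<partial>lborel)
          \<le> ennreal (A * R powr (real DIM('a)) * (1 + R / \<sigma> x) powr \<theta>) * ?M"
      proof -
        have "ennreal_powr z 1 = z" for z by (cases z) (auto simp: ennreal_powr_def)
        then show ?thesis using avg[of 1 R w x] R w0 by simp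
      qed
      also have "ennreal c * (ennreal (A * R powr (real DIM('a)) * (1 + R / \<sigma> x) powr \<theta>) * ?M)
         = ennreal (c * (A * R powr (real DIM('a)) * (1 + R / \<sigma> x) powr \<theta>)) * ?M"
        using c A by (simp add: ennreal_mult mult.assoc)
      also have "c * (A * R powr (real DIM('a)) * (1 + R / \<sigma> x) powr \<theta>)
          = 2 powr a * A * (R powr (- real DIM('a)) * R powr (real DIM('a))) *
            (decay a b (R / \<sigma> x) * (1 + R / \<sigma> x) powr \<theta>)"
        by (simp add: c_def mult_ac)
      also have "\<dots> = decay a (b - \<theta>) (R / \<sigma> x) * (2 powr a * A)"
        using R spos by (subst decay_mult_growth) (auto simp: powr_minus)
      also have "ennreal (\<dots>) * ?M = ennreal (decay a (b - \<theta>) (R / \<sigma> x)) * (ennreal (2 powr a * A) * ?M)"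
        using A by (subst ennreal_mult) (auto simp: decay_def mult.assoc)
      finally show "(\<integral>\<^sup>+y\<in>annulus x R. ennreal (radial_kernel \<sigma> a b x y * w y) \<partial>lborel)
        \<le> ennreal (decay a (b - \<theta>) (R / \<sigma> x)) * (ennreal (2 powr a * A) * ?M)"
        by (simp add: mult_left_mono)
    qed (use b in auto)
    then show "(\<integral>\<^sup>+y. ennreal (radial_kernel \<sigma> a b x y * w y) \<partial>lborel)
        \<le> ennreal (C * (2 powr a * A)) * ?M"
      using C A by (simp add: ennreal_mult mult.assoc)
  qed
qed

text \<open>The hypothesis on the kernel enters only here, with \<open>y\<close> as the centre of the annuli. The
  factor \<open>radial_kernel powr (1 - p)\<close> is chosen so that all powers of \<open>R\<close> cancel.\<close>

lemma weighted_kernel_bound: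
  fixes \<rho> \<sigma> :: "'a::euclidean_space \<Rightarrow> real" and k :: "'a \<Rightarrow> 'a \<Rightarrow> real"
  assumes \<rho>: "\<And>x. 0 < \<rho> x" and L: "1 \<le> L" and \<sigma>: "\<And>x. \<rho> x \<le> \<sigma> x" "\<And>x. \<sigma> x \<le> L * \<rho> x"
    and \<theta>: "0 \<le> \<theta>" and \<delta>: "0 < \<delta>" and b: "0 \<le> b" and s: "1 < s" and D: "1 \<le> D"
    and k0: "\<And>x y. 0 \<le> k x y" and k_meas: "\<And>y. (\<lambda>x. k x y) \<in> borel_measurable borel"
    and hyp: "\<And>y R. 0 < R \<Longrightarrow>
      ennreal_powr (\<integral>\<^sup>+x\<in>annulus y R. ennreal (k x y powr s) \<partial>lborel) (1 / s)
      \<le> ennreal (D * R powr (- (real DIM('a) / conj_exp s)) * decay \<delta> (b + \<theta> + 1) (R / \<sigma> y))"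
  obtains C where "0 < C"
    "\<And>p w y. \<lbrakk>1 \<le> p; p < s; w \<in> borel_measurable borel; \<forall>x. 0 \<le> w x\<rbrakk> \<Longrightarrow>
      (\<integral>\<^sup>+x. ennreal (k x y powr p * radial_kernel \<sigma> \<delta> b y x powr (1 - p) * w x) \<partial>lborel)
      \<le> ennreal C * maximal_function \<rho> \<theta> (conj_exp (s / p)) w y"
proof -
  obtain A where A: "1 \<le> A" and avg: "\<And>r w y R. 1 \<le> r \<Longrightarrow> 0 < R \<Longrightarrow>
      ennreal_powr (\<integral>\<^sup>+x\<in>annulus y R. ennreal (w x powr r) \<partial>lborel) (1 / r)
      \<le> ennreal (A * R powr (real DIM('a) / r) * (1 + R / \<sigma> y) powr \<theta>) * maximal_function \<rho> \<theta> r w y"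
    by (rule annulus_average_le_maximal_function[OF \<rho> L \<sigma> \<theta>]) (rule that)
  define C where "C = annuli_const \<delta> (b + 1)"
  have C: "0 < C" using \<delta> b by (simp add: C_def annuli_const_pos)
  note annuli = nn_integral_le_annuli[OF \<delta>, of "b + 1", folded C_def]
  \<comment> \<open>The three factors come from the lower bound on the radial kernel, the kernel
    condition and the averages of w^r. The first two occur with exponents p - 1 and p; their bases
    are at least 1, so raising the exponents to s removes the dependence on p.\<close>
  define E where "E = (2 powr (real DIM('a) + \<delta> + b)) powr s * D powr s * A"
  have E: "0 < E" using A D by (simp add: E_def)
  show thesis
  proof
    show "0 < C * E" using C E by simp
    fix p :: real and w :: "'a \<Rightarrow> real" and y :: 'a
    assume p: "1 \<le> p" "p < s" and w [measurable]: "w \<in> borel_measurable borel" and "\<forall>x. 0 \<le> w x"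
    then have w0: "\<And>x. 0 \<le> w x" by simp
    define r where "r = conj_exp (s / p)"
    let ?M = "maximal_function \<rho> \<theta> r w y"
    have r: "1 / r = 1 - p / s" "1 < r"
      using p s by (auto simp: r_def conj_exp_def field_simps)
    have spos: "0 < \<sigma> y" using \<rho>[of y] \<sigma>(1)[of y] by linarith
    note [measurable] = k_meas
    have "(\<integral>\<^sup>+x. ennreal (k x y powr p * radial_kernel \<sigma> \<delta> b y x powr (1 - p) * w x) \<partial>lborel)
      \<le> ennreal C * (ennreal E * ?M)"
    proof (rule annuli[OF _ _ spos, of _ y])
      fix R :: real assume R: "0 < R"
      define \<tau> where "\<tau> = R / \<sigma> y"
      have \<tau>: "0 < \<tau>" using R spos by (simp add: \<tau>_def)
      \<comment> \<open>Of the rate N, the part \<theta> is spent on the growth of the averages; the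
        remaining b + 1 is positive, and N \<ge> b allows the surplus powers in \<open>dec\<close>
        to cancel.\<close>
      define N where "N = b + \<theta> + 1"
      define B where "B = D * R powr (- (real DIM('a) / conj_exp s)) * decay \<delta> N \<tau>"
      have B: "0 < B" using D R decay_pos[OF \<tau>] by (simp add: B_def)
      define c where "c = 2 powr (real DIM('a) + \<delta> + b) * (R powr real DIM('a) * inverse (decay \<delta> b \<tau>))"
      have c: "0 < c" using R decay_pos[OF \<tau>] by (simp add: c_def)
      let ?A = "annulus y R"
      \<comment> \<open>As 1 - p \<le> 0, a lower bound on the radial kernel is required; c bounds
        its inverse on the annulus, which omits the centre.\<close>
      have rk: "radial_kernel \<sigma> \<delta> b y x powr (1 - p) \<le> c powr (p - 1)" if "x \<in> ?A" for x
      proof -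
        have "x \<noteq> y" using that R by (auto simp: annulus_def)
        then have pos: "0 < radial_kernel \<sigma> \<delta> b y x"
          using spos by (intro radial_kernel_pos) auto
        have "R powr (- real DIM('a)) * decay \<delta> b \<tau> \<le> 2 powr (real DIM('a) + \<delta> + b) * radial_kernel \<sigma> \<delta> b y x"
          unfolding \<tau>_def using radial_kernel_annulus(2)[of \<delta> b R \<sigma> y x] that \<delta> b R spos by simp
        then have "inverse (radial_kernel \<sigma> \<delta> b y x) \<le> c"
          using pos R decay_pos[OF \<tau>, of \<delta> b] by (simp add: c_def powr_minus field_simps)
        then have "inverse (radial_kernel \<sigma> \<delta> b y x) powr (p - 1) \<le> c powr (p - 1)"
          using pos p by (intro powr_mono2) auto
        then show ?thesis
          using pos by (simp add: inverse_powr powr_minus[symmetric])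
      qed
      \<comment> \<open>Hoelder's inequality is prepared with exponents 1 / r on w^r and 1 - 1 / r =
        p / s on k^s. The indicators may stand inside the powers because both exponents are
        positive.\<close>
      have "(\<integral>\<^sup>+x\<in>?A. ennreal (k x y powr p * radial_kernel \<sigma> \<delta> b y x powr (1 - p) * w x) \<partial>lborel)
        \<le> (\<integral>\<^sup>+x. ennreal (c powr (p - 1)) *
            ennreal ((w x powr r * indicator ?A x) powr (1 / r) * (k x y powr s * indicator ?A x) powr (1 - 1 / r)) \<partial>lborel)"
      proof (intro nn_integral_mono)
        fix x
        show "ennreal (k x y powr p * radial_kernel \<sigma> \<delta> b y x powr (1 - p) * w x) * indicator ?A x
          \<le> ennreal (c powr (p - 1)) * ennreal ((w x powr r * indicator ?A x) powr (1 / r) * (k x y powr s * indicator ?A x) powr (1 - 1 / r))"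
        proof (cases "x \<in> ?A")
          case True
          have "(w x powr r) powr (1 / r) = w x"
            using r(2) w0[of x] by (simp add: powr_powr)
          moreover have "(k x y powr s) powr (1 - 1 / r) = k x y powr p"
            using r(1) s by (simp add: powr_powr)
          moreover have "k x y powr p * radial_kernel \<sigma> \<delta> b y x powr (1 - p) * w x \<le> k x y powr p * c powr (p - 1) * w x"
            using rk[OF True] w0 by (intro mult_right_mono mult_left_mono) auto
          ultimately show ?thesis
            using True by (simp add: ennreal_mult[symmetric] w0 mult_ac)
        qed simp
      qed
      also have "\<dots> = ennreal (c powr (p - 1)) *
        (\<integral>\<^sup>+x. ennreal ((w x powr r * indicator ?A x) powr (1 / r) * (k x y powr s * indicator ?A x) powr (1 - 1 / r)) \<partial>lborel)"
        by (subst nn_integral_cmult) auto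
      also have "\<dots> \<le> ennreal (c powr (p - 1)) *
        (ennreal_powr (\<integral>\<^sup>+x. ennreal (w x powr r * indicator ?A x) \<partial>lborel) (1 / r) * ennreal ((B powr s) powr (1 - 1 / r)))"
      proof (intro mult_left_mono nn_integral_Holder)
        have "(\<integral>\<^sup>+x\<in>?A. ennreal (k x y powr s) \<partial>lborel) \<le> ennreal (B powr s)"
          using hyp[OF R, of y] s B unfolding B_def N_def \<tau>_def by (intro ennreal_le_powr_inverse) auto
        also have "(\<integral>\<^sup>+x\<in>?A. ennreal (k x y powr s) \<partial>lborel) = (\<integral>\<^sup>+x. ennreal (k x y powr s * indicator ?A x) \<partial>lborel)"
          by (intro nn_integral_cong) (auto simp: indicator_def)
        finally show "(\<integral>\<^sup>+x. ennreal (k x y powr s * indicator ?A x) \<partial>lborel) \<le> ennreal (B powr s)" .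
      qed (use B r p s in auto)
      also have "(B powr s) powr (1 - 1 / r) = B powr p"
        using r(1) s by (simp add: powr_powr)
      also have "(\<integral>\<^sup>+x. ennreal (w x powr r * indicator ?A x) \<partial>lborel) = (\<integral>\<^sup>+x\<in>?A. ennreal (w x powr r) \<partial>lborel)"
        by (intro nn_integral_cong) (auto simp: indicator_def)
      also have "ennreal (c powr (p - 1)) *
         (ennreal_powr (\<integral>\<^sup>+x\<in>?A. ennreal (w x powr r) \<partial>lborel) (1 / r) * ennreal (B powr p))
        \<le> ennreal (c powr (p - 1)) *
          ((ennreal (A * R powr (real DIM('a) / r) * (1 + R / \<sigma> y) powr \<theta>) * ?M) * ennreal (B powr p))"
        using r by (intro mult_left_mono mult_right_mono avg R) auto
      also have "\<dots> = ennreal (c powr (p - 1) * (A * R powr (real DIM('a) / r) * (1 + \<tau>) powr \<theta> * B powr p)) * ?M"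
        using A by (simp add: ennreal_mult \<tau>_def mult_ac)
      also have "c powr (p - 1) * (A * R powr (real DIM('a) / r) * (1 + \<tau>) powr \<theta> * B powr p)
          \<le> decay \<delta> (b + 1) \<tau> * E"
      proof -
        define e where "e = real DIM('a)"
        \<comment> \<open>With 1 / r = 1 - p / s and 1 / s' = 1 - 1 / s, the exponent is d times (p
          - 1) + (1 - p / s) - p (1 - 1 / s), which is 0.\<close>
        have R1: "R powr (e * (p - 1)) * R powr (e / r) * R powr (- (e / conj_exp s) * p) = 1"
        proof -
          have "e * (p - 1) + e / r + (- (e / conj_exp s) * p) = e * (p - 1 + 1 / r - p / conj_exp s)"
            by (simp add: algebra_simps)
          also have "p - 1 + 1 / r - p / conj_exp s = 0"
            using s unfolding r(1) by (simp add: conj_exp_def field_simps)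
          finally show ?thesis using R by (simp add: powr_add[symmetric])
        qed
        have cp: "c powr (p - 1) = (2 powr (e + \<delta> + b)) powr (p - 1) * (R powr (e * (p - 1)) * inverse (decay \<delta> b \<tau> powr (p - 1)))"
          using R decay_pos[OF \<tau>, of \<delta> b] by (simp add: c_def e_def powr_mult powr_powr inverse_powr)
        have Bp: "B powr p = D powr p * (R powr (- (e / conj_exp s) * p) * decay \<delta> N \<tau> powr p)"
          using R D decay_pos[OF \<tau>, of \<delta> N] by (simp add: B_def e_def powr_mult powr_powr mult.assoc)
        \<comment> \<open>Of the p powers of the faster decay, p - 1 cancel against the slower one,
          and the single power left absorbs (1 + \<tau>)^\<theta>.\<close>
        have dec: "inverse (decay \<delta> b \<tau> powr (p - 1)) * decay \<delta> N \<tau> powr p * (1 + \<tau>) powr \<theta> \<le> decay \<delta> (b + 1) \<tau>"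
        proof -
          have "decay \<delta> N \<tau> powr p = decay \<delta> N \<tau> * decay \<delta> N \<tau> powr (p - 1)"
            using decay_pos[OF \<tau>, of \<delta> N] powr_add[of "decay \<delta> N \<tau>" 1 "p - 1"] by simp
          also have "\<dots> \<le> decay \<delta> N \<tau> * decay \<delta> b \<tau> powr (p - 1)"
            using decay_pos[OF \<tau>, of \<delta> N] decay_mono[OF \<tau>, of b N \<delta>] \<theta> p
            by (intro mult_left_mono powr_mono2) (auto simp: N_def)
          finally have "inverse (decay \<delta> b \<tau> powr (p - 1)) * decay \<delta> N \<tau> powr p \<le> decay \<delta> N \<tau>"
            using decay_pos[OF \<tau>, of \<delta> b] by (simp add: field_simps)
          then have "inverse (decay \<delta> b \<tau> powr (p - 1)) * decay \<delta> N \<tau> powr p * (1 + \<tau>) powr \<theta>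
              \<le> decay \<delta> N \<tau> * (1 + \<tau>) powr \<theta>"
            by (intro mult_right_mono) auto
          also have "\<dots> = decay \<delta> (b + 1) \<tau>"
            using \<tau> by (simp add: decay_mult_growth N_def)
          finally show ?thesis .
        qed
        have "c powr (p - 1) * (A * R powr (e / r) * (1 + \<tau>) powr \<theta> * B powr p)
          = ((2 powr (e + \<delta> + b)) powr (p - 1) * D powr p * A) *
            (R powr (e * (p - 1)) * R powr (e / r) * R powr (- (e / conj_exp s) * p)) *
            (inverse (decay \<delta> b \<tau> powr (p - 1)) * decay \<delta> N \<tau> powr p * (1 + \<tau>) powr \<theta>)"
          unfolding cp Bp by (simp only: mult_ac)
        also have "\<dots> \<le> E * 1 * decay \<delta> (b + 1) \<tau>"
          unfolding R1
        proof (intro mult_mono dec)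
          have "1 \<le> 2 powr (e + \<delta> + b)"
            using \<delta> b by (intro ge_one_powr_ge_zero) (auto simp: e_def)
          then show "(2 powr (e + \<delta> + b)) powr (p - 1) * D powr p * A \<le> E"
            unfolding E_def e_def[symmetric] using p D A by (intro mult_mono powr_mono) auto
        qed (use E decay_pos[OF \<tau>, of \<delta> "b + 1"] in auto)
        finally show ?thesis by (simp add: e_def mult_ac)
      qed
      also have "ennreal (decay \<delta> (b + 1) \<tau> * E) * ?M = ennreal (decay \<delta> (b + 1) \<tau>) * (ennreal E * ?M)"
        using E by (subst ennreal_mult) (auto simp: decay_def mult.assoc)
      finally show "(\<integral>\<^sup>+x\<in>?A. ennreal (k x y powr p * radial_kernel \<sigma> \<delta> b y x powr (1 - p) * w x) \<partial>lborel)
         \<le> ennreal (decay \<delta> (b + 1) (R / \<sigma> y)) * (ennreal E * ?M)"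
        unfolding \<tau>_def by (simp add: mult_right_mono ennreal_leI)
    qed (use b in auto)
    then show "(\<integral>\<^sup>+x. ennreal (k x y powr p * radial_kernel \<sigma> \<delta> b y x powr (1 - p) * w x) \<partial>lborel)
      \<le> ennreal (C * E) * maximal_function \<rho> \<theta> (conj_exp (s / p)) w y"
      using C E by (simp add: ennreal_mult mult.assoc r_def)
  qed
qed

subsection \<open>The operator and its adjoint\<close>

text \<open>The inverse constant is moved onto the measurable G, so that H may be arbitrary; in its
  uses H contains an unspecified majorant M.\<close>

lemma nn_integral_le_cmult:
  assumes [measurable]: "G \<in> borel_measurable M" and C: "0 < C" and le: "\<And>x. G x \<le> ennreal C * H x"
  shows "(\<integral>\<^sup>+x. G x \<partial>M) \<le> ennreal C * (\<integral>\<^sup>+x. H x \<partial>M)"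
proof -
  have inv: "ennreal C * (ennreal (inverse C) * z) = z" "ennreal (inverse C) * (ennreal C * z) = z" for z
    using C by (simp_all add: mult.assoc[symmetric] ennreal_mult[symmetric])
  have "(\<integral>\<^sup>+x. G x \<partial>M) = ennreal C * (\<integral>\<^sup>+x. ennreal (inverse C) * G x \<partial>M)"
    by (subst nn_integral_cmult[symmetric]) (auto simp: inv)
  also have "\<dots> \<le> ennreal C * (\<integral>\<^sup>+x. H x \<partial>M)"
  proof (intro mult_left_mono nn_integral_mono)
    fix x
    have "ennreal (inverse C) * G x \<le> ennreal (inverse C) * (ennreal C * H x)"
      by (intro mult_left_mono le) auto
    then show "ennreal (inverse C) * G x \<le> H x" by (simp add: inv)
  qed auto
  finally show ?thesis .
qed

lemma lborel_Tonelli: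
  fixes f :: "'a::euclidean_space \<Rightarrow> 'b::euclidean_space \<Rightarrow> ennreal"
  assumes "(\<lambda>(x, y). f x y) \<in> borel_measurable (borel \<Otimes>\<^sub>M borel)"
  shows "(\<integral>\<^sup>+x. \<integral>\<^sup>+y. f x y \<partial>lborel \<partial>lborel) = (\<integral>\<^sup>+y. \<integral>\<^sup>+x. f x y \<partial>lborel \<partial>lborel)"
    and "(\<lambda>y. \<integral>\<^sup>+x. f x y \<partial>lborel) \<in> borel_measurable borel"
    and "(\<lambda>x. \<integral>\<^sup>+y. f x y \<partial>lborel) \<in> borel_measurable borel"
proof -
  have m: "(\<lambda>(x, y). f x y) \<in> borel_measurable (lborel \<Otimes>\<^sub>M lborel)"
    using assms by (simp cong: measurable_cong_sets sets_pair_measure_cong)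
  then show "(\<integral>\<^sup>+x. \<integral>\<^sup>+y. f x y \<partial>lborel \<partial>lborel) = (\<integral>\<^sup>+y. \<integral>\<^sup>+x. f x y \<partial>lborel \<partial>lborel)"
    by (rule lborel_pair.Fubini'[symmetric])
  from m show "(\<lambda>x. \<integral>\<^sup>+y. f x y \<partial>lborel) \<in> borel_measurable borel"
    using lborel.borel_measurable_nn_integral[of f lborel] by simp
  from measurable_pair_swap[OF m] show "(\<lambda>y. \<integral>\<^sup>+x. f x y \<partial>lborel) \<in> borel_measurable borel"
    using lborel.borel_measurable_nn_integral[of "\<lambda>y x. f x y" lborel] by (simp add: split_beta')
qed

text \<open>The p-th power of Hoelder's inequality, since (1 - 1 / p) p = p - 1. With G = \<psi> it
  is Jensen's inequality for T; for the adjoint, G is the weighted power of the kernel.\<close>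

lemma powr_le_Holder:
  assumes FG: "F \<in> borel_measurable M" "G \<in> borel_measurable M" "\<And>x. 0 \<le> F x" "\<And>x. 0 \<le> G x"
    and G: "(\<integral>\<^sup>+x. ennreal (G x) \<partial>M) \<le> ennreal B" and B: "0 < B" and p: "1 \<le> p" and z: "0 \<le> z"
    and le: "ennreal z \<le> (\<integral>\<^sup>+x. ennreal (F x powr (1 / p) * G x powr (1 - 1 / p)) \<partial>M)"
  shows "ennreal (z powr p) \<le> ennreal (B powr (p - 1)) * (\<integral>\<^sup>+x. ennreal (F x) \<partial>M)"
proof (cases "\<integral>\<^sup>+x. ennreal (F x) \<partial>M")
  case (real X)
  have "ennreal z \<le> ennreal_powr (\<integral>\<^sup>+x. ennreal (F x) \<partial>M) (1 / p) * ennreal (B powr (1 - 1 / p))"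
    using le nn_integral_Holder[OF FG _ _ G B, of "1 / p"] p by (auto elim: order_trans)
  with real have "z \<le> X powr (1 / p) * B powr (1 - 1 / p)"
    by (simp add: ennreal_mult[symmetric])
  then have "z powr p \<le> (X powr (1 / p) * B powr (1 - 1 / p)) powr p"
    using z p by (intro powr_mono2) auto
  also have "\<dots> = X * B powr (p - 1)"
    using real p by (simp add: powr_mult powr_powr left_diff_distrib)
  finally show ?thesis
    using real by (simp add: ennreal_mult[symmetric] mult.commute)
next
  case top
  then show ?thesis using B by (simp add: ennreal_mult_top)
qed

section \<open>Weighted bounds for the operator\<close>

lemma kernel_measurable:
  fixes K :: "'a::euclidean_space \<Rightarrow> 'a \<Rightarrow> complex"
  assumes "linear_operator_with_kernel T K"
  shows "(\<lambda>z. K (fst z) (snd z)) \<in> borel_measurable (borel \<Otimes>\<^sub>M borel)"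
    and "(\<lambda>x. K x y) \<in> borel_measurable borel" and "K x \<in> borel_measurable borel"
proof -
  show m: "(\<lambda>z. K (fst z) (snd z)) \<in> borel_measurable (borel \<Otimes>\<^sub>M borel)"
    using assms by (simp add: linear_operator_with_kernel_def split_beta')
  show "(\<lambda>x. K x y) \<in> borel_measurable borel"
    using measurable_compose[OF measurable_Pair2'[of y borel borel] m] by simp
  show "K x \<in> borel_measurable borel"
    using measurable_compose[OF measurable_Pair1'[of x borel borel] m] by simp
qed

lemma norm_operator_le:
  assumes T: "linear_operator_with_kernel T K" and f: "f \<in> kernel_domain K"
  shows "AE x in lborel. ennreal (norm (T f x)) \<le> (\<integral>\<^sup>+y. ennreal (norm (K x y) * norm (f y)) \<partial>lborel)"
proof -
  have "AE x in lborel. T f x = (\<integral>y. K x y * f y \<partial>lborel)"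
    using assms by (simp add: linear_operator_with_kernel_def)
  moreover have "AE x in lborel. integrable lborel (\<lambda>y. K x y * f y)"
    using f by (simp add: kernel_domain_def)
  ultimately show ?thesis
  proof eventually_elim
    case (elim x)
    then show ?case
      using integral_norm_bound_ennreal[OF elim(2)] by (simp add: norm_mult)
  qed
qed

text \<open>Two auxiliary kernels occur because Jensen's inequality integrates in y with the scale
  at x, whereas the kernel estimate \<open>inner\<close> integrates in x with the scale at y. After
  Jensen, \<open>swap\<close> changes the centre, and Tonelli's theorem leaves exactly the integral
  in \<open>inner\<close>.\<close>

lemma operator_weighted_bound:
  fixes K :: "'a::euclidean_space \<Rightarrow> 'a \<Rightarrow> complex"
  assumes T: "linear_operator_with_kernel T K"
    and \<psi>_meas: "(\<lambda>(x, y). \<psi> x y) \<in> borel_measurable (borel \<Otimes>\<^sub>M borel)"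
    and \<psi>'_meas: "(\<lambda>(x, y). \<psi>' x y) \<in> borel_measurable (borel \<Otimes>\<^sub>M borel)"
    and \<psi>0: "\<And>x y. 0 \<le> \<psi> x y" and \<psi>'0: "\<And>x y. x \<noteq> y \<Longrightarrow> 0 < \<psi>' x y"
    and swap: "\<And>x y. \<psi>' y x \<le> Cs * \<psi> x y" and Cs: "1 \<le> Cs"
    and A: "\<And>x. (\<integral>\<^sup>+y. ennreal (\<psi> x y) \<partial>lborel) \<le> ennreal A" "1 \<le> A"
    and C: "0 < C" and p: "1 \<le> p" "p < s"
    and w: "w \<in> borel_measurable borel" "\<And>x. 0 \<le> w x" and f: "f \<in> kernel_domain K"
    and inner: "\<And>y. (\<integral>\<^sup>+x. ennreal (norm (K x y) powr p * \<psi>' y x powr (1 - p) * w x) \<partial>lborel) \<le> ennreal C * M y"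
  shows "(\<integral>\<^sup>+x. ennreal (norm (T f x) powr p * w x) \<partial>lborel)
    \<le> ennreal ((A * Cs) powr s * C) * (\<integral>\<^sup>+x. ennreal (norm (f x) powr p) * M x \<partial>lborel)"
proof -
  \<comment> \<open>Jensen and the change of centre each contribute a power p - 1; as A Cs \<ge> 1,
    the exponent s dominates for all p < s at once.\<close>
  define D where "D = (A * Cs) powr s"
  have ACs: "1 \<le> A * Cs" using A(2) Cs mult_mono[of 1 A 1 Cs] by simp
  have D: "0 < D" unfolding D_def using A(2) Cs by simp
  note [measurable] = kernel_measurable[OF T] w(1)
  have [measurable]: "f \<in> borel_measurable borel" using f by (simp add: kernel_domain_def)
  have [measurable]: "(\<lambda>z. \<psi> (fst z) (snd z)) \<in> borel_measurable (borel \<Otimes>\<^sub>M borel)"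
    "(\<lambda>z. \<psi>' (fst z) (snd z)) \<in> borel_measurable (borel \<Otimes>\<^sub>M borel)"
    using \<psi>_meas \<psi>'_meas by (auto simp: split_beta')
  have [measurable]: "(\<lambda>z. \<psi>' (snd z) (fst z)) \<in> borel_measurable (borel \<Otimes>\<^sub>M borel)"
    using measurable_pair_swap[OF \<psi>'_meas] by (simp add: split_beta')
  have [measurable]: "\<psi> x \<in> borel_measurable borel" for x
    using measurable_compose[OF measurable_Pair1'[of x borel borel] \<psi>_meas] by simp
  have [measurable]: "(\<lambda>x. \<psi>' y x) \<in> borel_measurable borel" for y
    using measurable_compose[OF measurable_Pair1'[of y borel borel] \<psi>'_meas] by simp
  define Q where "Q x y = D * (norm (f y) powr p * (norm (K x y) powr p * \<psi>' y x powr (1 - p) * w x))" for x y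
  have "AE x in lborel. ennreal (norm (T f x) powr p * w x) \<le> (\<integral>\<^sup>+y. ennreal (Q x y) \<partial>lborel)"
    using norm_operator_le[OF T f]
  proof eventually_elim
    case (elim x)
    have pos: "0 < \<psi> x y" if "x \<noteq> y" for y
      using swap[of y x] \<psi>'0[of y x] that Cs by (smt (verit) zero_less_mult_iff)
    define F where "F y = (norm (K x y) * norm (f y)) powr p * \<psi> x y powr (1 - p)" for y
    have [measurable]: "F \<in> borel_measurable borel"
      unfolding F_def by measurable
    have "ennreal (norm (T f x)) \<le> (\<integral>\<^sup>+y. ennreal (norm (K x y) * norm (f y)) \<partial>lborel)"
      by (fact elim)
    also have "\<dots> = (\<integral>\<^sup>+y. ennreal (F y powr (1 / p) * \<psi> x y powr (1 - 1 / p)) \<partial>lborel)"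
    \<comment> \<open>The total exponent of \<psi> is (1 - p) / p + (1 - 1 / p) = 0. The powers
      cancel only where \<psi> is positive, that is, off the null diagonal.\<close>
    proof (intro nn_integral_cong_AE eventually_mono[OF AE_lborel_singleton[of x]])
      fix y assume "y \<noteq> x"
      with pos[of y] have "0 < \<psi> x y" by simp
      moreover have "(1 - p) * (1 / p) + (1 - 1 / p) = 0"
        using p by (simp add: field_simps)
      ultimately have "\<psi> x y powr ((1 - p) * (1 / p)) * \<psi> x y powr (1 - 1 / p) = 1"
        by (simp only: powr_add[symmetric]) simp
      then have "F y powr (1 / p) * \<psi> x y powr (1 - 1 / p) = norm (K x y) * norm (f y)"
        using p by (simp add: F_def powr_mult powr_powr mult.assoc)
      then show "ennreal (norm (K x y) * norm (f y)) = ennreal (F y powr (1 / p) * \<psi> x y powr (1 - 1 / p))"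
        by simp
    qed
    finally have "ennreal (norm (T f x) powr p) \<le> ennreal (A powr (p - 1)) * (\<integral>\<^sup>+y. ennreal (F y) \<partial>lborel)"
      using A p \<psi>0 by (intro powr_le_Holder[of F _ "\<psi> x"]) (auto simp: F_def)
    then have "ennreal (norm (T f x) powr p * w x)
        \<le> ennreal (A powr (p - 1)) * (\<integral>\<^sup>+y. ennreal (F y) \<partial>lborel) * ennreal (w x)"
      using w by (simp add: ennreal_mult mult_right_mono)
    also have "\<dots> = (\<integral>\<^sup>+y. ennreal (A powr (p - 1) * F y * w x) \<partial>lborel)"
      by (simp add: ennreal_mult w nn_integral_cmult nn_integral_multc F_def)
    also have "\<dots> \<le> (\<integral>\<^sup>+y. ennreal (Q x y) \<partial>lborel)"
    proof (intro nn_integral_mono_AE eventually_mono[OF AE_lborel_singleton[of x]])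
      fix y assume "y \<noteq> x"
      then have pos': "0 < \<psi> x y" "0 < \<psi>' y x" using pos \<psi>'0 by auto
      \<comment> \<open>The exponent is nonpositive, so the lower bound \<psi>' / Cs for \<psi>
        becomes an upper bound for the power.\<close>
      have "\<psi> x y powr (1 - p) = inverse (\<psi> x y powr (p - 1))"
        by (simp add: powr_minus[symmetric])
      also have "\<dots> \<le> inverse ((\<psi>' y x / Cs) powr (p - 1))"
        using pos' Cs p swap[of y x] by (intro le_imp_inverse_le powr_mono2) (auto simp: field_simps)
      also have "\<dots> = Cs powr (p - 1) * \<psi>' y x powr (1 - p)"
        using pos' Cs powr_minus[of "\<psi>' y x" "p - 1"] by (simp add: powr_divide inverse_eq_divide)
      finally have \<psi>le: "\<psi> x y powr (1 - p) \<le> Cs powr (p - 1) * \<psi>' y x powr (1 - p)" .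
      have "A powr (p - 1) * F y * w x = (norm (K x y) * norm (f y)) powr p * w x * (A powr (p - 1) * \<psi> x y powr (1 - p))"
        by (simp add: F_def mult_ac)
      also have "\<dots> \<le> (norm (K x y) * norm (f y)) powr p * w x * (D * \<psi>' y x powr (1 - p))"
      proof (intro mult_left_mono)
        have "A powr (p - 1) * \<psi> x y powr (1 - p) \<le> A powr (p - 1) * (Cs powr (p - 1) * \<psi>' y x powr (1 - p))"
          by (intro mult_left_mono \<psi>le) auto
        also have "\<dots> = (A * Cs) powr (p - 1) * \<psi>' y x powr (1 - p)"
          using A Cs by (simp add: powr_mult)
        also have "\<dots> \<le> D * \<psi>' y x powr (1 - p)"
          unfolding D_def using p ACs by (intro mult_right_mono powr_mono) auto
        finally show "A powr (p - 1) * \<psi> x y powr (1 - p) \<le> D * \<psi>' y x powr (1 - p)" .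
      qed (use w in auto)
      also have "\<dots> = Q x y"
        by (simp add: Q_def powr_mult mult_ac)
      finally show "ennreal (A powr (p - 1) * F y * w x) \<le> ennreal (Q x y)"
        by (rule ennreal_leI)
    qed
    finally show ?case .
  qed
  then have "(\<integral>\<^sup>+x. ennreal (norm (T f x) powr p * w x) \<partial>lborel) \<le> (\<integral>\<^sup>+x. \<integral>\<^sup>+y. ennreal (Q x y) \<partial>lborel \<partial>lborel)"
    by (rule nn_integral_mono_AE)
  also have Qm: "(\<lambda>(x, y). ennreal (Q x y)) \<in> borel_measurable (borel \<Otimes>\<^sub>M borel)"
    unfolding Q_def split_beta' by measurable
  have "(\<integral>\<^sup>+x. \<integral>\<^sup>+y. ennreal (Q x y) \<partial>lborel \<partial>lborel) = (\<integral>\<^sup>+y. \<integral>\<^sup>+x. ennreal (Q x y) \<partial>lborel \<partial>lborel)"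
    by (rule lborel_Tonelli(1)[OF Qm])
  also have "\<dots> \<le> ennreal (D * C) * (\<integral>\<^sup>+y. ennreal (norm (f y) powr p) * M y \<partial>lborel)"
  proof (rule nn_integral_le_cmult)
    show "(\<lambda>y. \<integral>\<^sup>+x. ennreal (Q x y) \<partial>lborel) \<in> borel_measurable lborel"
      using lborel_Tonelli(2)[OF Qm] by simp
    show "0 < D * C" using D C by simp
    fix y
    have "(\<integral>\<^sup>+x. ennreal (Q x y) \<partial>lborel) = ennreal (D * norm (f y) powr p) *
        (\<integral>\<^sup>+x. ennreal (norm (K x y) powr p * \<psi>' y x powr (1 - p) * w x) \<partial>lborel)"
      using D w by (subst nn_integral_cmult[symmetric]) (auto simp: Q_def ennreal_mult[symmetric] mult_ac)
    also have "\<dots> \<le> ennreal (D * norm (f y) powr p) * (ennreal C * M y)"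
      by (intro mult_left_mono inner) auto
    also have "\<dots> = ennreal (D * C) * (ennreal (norm (f y) powr p) * M y)"
      using D C by (simp add: ennreal_mult mult_ac)
    finally show "(\<integral>\<^sup>+x. ennreal (Q x y) \<partial>lborel) \<le> ennreal (D * C) * (ennreal (norm (f y) powr p) * M y)" .
  qed
  finally show ?thesis by (simp add: D_def)
qed

section \<open>The adjoint operator\<close>

lemma test_functions_subset_kernel_domain:
  fixes K :: "'a::euclidean_space \<Rightarrow> 'a \<Rightarrow> complex"
  assumes T: "linear_operator_with_kernel T K"
    and col: "\<And>y. (\<integral>\<^sup>+x. ennreal (norm (K x y)) \<partial>lborel) \<le> ennreal c"
  shows "test_functions \<subseteq> kernel_domain K"
proof
  fix \<phi> :: "'a \<Rightarrow> complex" assume "\<phi> \<in> test_functions"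
  then have [measurable]: "\<phi> \<in> borel_measurable borel" and "bounded (range \<phi>)" "bounded {x. \<phi> x \<noteq> 0}"
    by (auto simp: test_functions_def)
  then obtain b r where b: "\<And>x. norm (\<phi> x) \<le> b" and r: "{x. \<phi> x \<noteq> 0} \<subseteq> cball 0 r"
    by (auto simp: bounded_iff subset_iff)
  note [measurable] = kernel_measurable[OF T]
  have m: "(\<lambda>(x, y). ennreal (norm (K x y) * norm (\<phi> y))) \<in> borel_measurable (borel \<Otimes>\<^sub>M borel)"
    unfolding split_beta' by measurable
  \<comment> \<open>After Tonelli, the column bound c and the bounded support make this at most c b
    times the volume of a ball. So the inner integral is finite for almost every x, and T acts on
    test functions through its kernel.\<close>
  have "(\<integral>\<^sup>+x. \<integral>\<^sup>+y. ennreal (norm (K x y) * norm (\<phi> y)) \<partial>lborel \<partial>lborel)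
      = (\<integral>\<^sup>+y. \<integral>\<^sup>+x. ennreal (norm (K x y) * norm (\<phi> y)) \<partial>lborel \<partial>lborel)"
    by (rule lborel_Tonelli(1)[OF m])
  also have "\<dots> \<le> (\<integral>\<^sup>+y. (ennreal c * ennreal b) * indicator (cball (0::'a) r) y \<partial>lborel)"
  proof (intro nn_integral_mono)
    fix y
    have "(\<integral>\<^sup>+x. ennreal (norm (K x y) * norm (\<phi> y)) \<partial>lborel) = (\<integral>\<^sup>+x. ennreal (norm (K x y)) \<partial>lborel) * ennreal (norm (\<phi> y))"
      by (subst nn_integral_multc[symmetric]) (auto simp: ennreal_mult)
    also have "\<dots> \<le> (ennreal c * ennreal b) * indicator (cball 0 r) y"
    proof (cases "\<phi> y = 0")
      case False
      with r have "y \<in> cball 0 r" by blast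
      then show ?thesis using col b by (auto intro!: mult_mono ennreal_leI)
    qed simp
    finally show "(\<integral>\<^sup>+x. ennreal (norm (K x y) * norm (\<phi> y)) \<partial>lborel) \<le> (ennreal c * ennreal b) * indicator (cball 0 r) y" .
  qed
  also have "\<dots> = (ennreal c * ennreal b) * emeasure lborel (cball (0::'a) r)"
    by (subst nn_integral_cmult_indicator) auto
  also have "\<dots> < \<infinity>"
    using emeasure_lborel_cball_finite[of "0::'a" r] by (auto simp: ennreal_mult_less_top)
  finally have fin: "(\<integral>\<^sup>+x. \<integral>\<^sup>+y. ennreal (norm (K x y) * norm (\<phi> y)) \<partial>lborel \<partial>lborel) \<noteq> \<infinity>"
    by simp
  have "AE x in lborel. (\<integral>\<^sup>+y. ennreal (norm (K x y) * norm (\<phi> y)) \<partial>lborel) \<noteq> \<infinity>"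
    using lborel_Tonelli(3)[OF m] fin by (intro nn_integral_PInf_AE) auto
  then have "AE x in lborel. integrable lborel (\<lambda>y. K x y * \<phi> y)"
    by eventually_elim (auto simp: integrable_iff_bounded norm_mult less_top)
  then show "\<phi> \<in> kernel_domain K"
    by (simp add: kernel_domain_def)
qed

text \<open>Testing against \<open>sgn h\<close> on the set where the claim fails needs Tonelli only, so that the
  right-hand side may be infinite.\<close>

lemma adjoint_kernel_bound:
  fixes K :: "'a::euclidean_space \<Rightarrow> 'a \<Rightarrow> complex"
  assumes T: "linear_operator_with_kernel T K"
    and col: "\<And>y. (\<integral>\<^sup>+x. ennreal (norm (K x y)) \<partial>lborel) \<le> ennreal c"
    and adj: "adjoint_pair T g h"
  shows "AE y in lborel. ennreal (norm (h y)) \<le> (\<integral>\<^sup>+x. ennreal (norm (K x y) * norm (g x)) \<partial>lborel)"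
proof -
  note [measurable] = kernel_measurable[OF T]
  have [measurable]: "g \<in> borel_measurable borel" "h \<in> borel_measurable borel"
    and h_int: "\<And>S. compact S \<Longrightarrow> set_integrable lborel S h"
    using adj by (auto simp: adjoint_pair_def locally_integrable_def)
  have m: "(\<lambda>(x, y). ennreal (norm (K x y) * norm (g x))) \<in> borel_measurable (borel \<Otimes>\<^sub>M borel)"
    unfolding split_beta' by measurable
  define S where "S y = (\<integral>\<^sup>+x. ennreal (norm (K x y) * norm (g x)) \<partial>lborel)" for y
  have [measurable]: "S \<in> borel_measurable borel"
    unfolding S_def by (rule lborel_Tonelli(2)[OF m])
  \<comment> \<open>Cutting to balls gives the test function bounded support and makes h integrable
    on the set.\<close>
  define E where "E n = {y. S y < ennreal (norm (h y))} \<inter> cball 0 (real n)" for n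
  have [measurable]: "E n \<in> sets borel" for n
    unfolding E_def by measurable
  have null: "AE y in lborel. y \<notin> E n" for n
  proof -
    \<comment> \<open>The phase is chosen so that the pairing of \<phi> with h is the integral of
      the modulus of h over \<open>E n\<close>.\<close>
    define \<phi> where "\<phi> y = indicator (E n) y * sgn (h y)" for y
    have [measurable]: "\<phi> \<in> borel_measurable borel"
      unfolding \<phi>_def sgn_div_norm by measurable
    have "norm (\<phi> y) \<le> 1" for y
      by (simp add: \<phi>_def norm_mult norm_sgn indicator_def)
    moreover have "{y. \<phi> y \<noteq> 0} \<subseteq> cball 0 (real n)"
      by (auto simp: \<phi>_def E_def indicator_def split: if_splits)
    ultimately have \<phi>: "\<phi> \<in> test_functions"
      unfolding test_functions_def by (auto simp: bounded_iff[of "range \<phi>"] intro: bounded_subset[OF bounded_cball])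
    then have dom: "\<phi> \<in> kernel_domain K"
      using test_functions_subset_kernel_domain[OF T col] by blast
    have hE: "\<phi> y * cnj (h y) = complex_of_real (indicator (E n) y * norm (h y))" for y
    proof -
      have "sgn (h y) * cnj (h y) = complex_of_real (norm (h y))"
        by (cases "h y = 0") (auto simp: sgn_eq complex_norm_square[symmetric] power2_eq_square)
      then show ?thesis by (cases "y \<in> E n") (auto simp: \<phi>_def)
    qed
    have int: "integrable lborel (\<lambda>y. indicator (E n) y * norm (h y))"
    proof (rule Bochner_Integration.integrable_bound)
      show "integrable lborel (\<lambda>y. indicator (cball 0 (real n)) y *\<^sub>R h y)"
        using h_int[of "cball 0 (real n)"] by (simp add: set_integrable_def)
    qed (auto simp: E_def indicator_def)
    have "(\<integral>\<^sup>+y. ennreal (norm (h y)) * indicator (E n) y \<partial>lborel) = (\<integral>\<^sup>+y. ennreal (indicator (E n) y * norm (h y)) \<partial>lborel)"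
      by (intro nn_integral_cong) (auto simp: indicator_def)
    also have hfin: "\<dots> = ennreal (\<integral>y. indicator (E n) y * norm (h y) \<partial>lborel)"
      by (intro nn_integral_eq_integral int) auto
    also have "\<dots> \<le> ennreal (norm (\<integral>x. T \<phi> x * cnj (g x) \<partial>lborel))"
    proof (rule ennreal_leI)
      have "(\<integral>x. T \<phi> x * cnj (g x) \<partial>lborel) = (\<integral>y. \<phi> y * cnj (h y) \<partial>lborel)"
        using adj \<phi> by (simp add: adjoint_pair_def)
      also have "\<dots> = complex_of_real (\<integral>y. indicator (E n) y * norm (h y) \<partial>lborel)"
        unfolding hE by (rule integral_complex_of_real)
      finally show "(\<integral>y. indicator (E n) y * norm (h y) \<partial>lborel) \<le> norm (\<integral>x. T \<phi> x * cnj (g x) \<partial>lborel)"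
        by simp
    qed
    also have "ennreal (norm (\<integral>x. T \<phi> x * cnj (g x) \<partial>lborel)) \<le> (\<integral>\<^sup>+x. ennreal (norm (T \<phi> x * cnj (g x))) \<partial>lborel)"
      using adj \<phi> by (intro integral_norm_bound_ennreal) (simp add: adjoint_pair_def)
    also have "\<dots> \<le> (\<integral>\<^sup>+x. \<integral>\<^sup>+y. ennreal (norm (K x y) * norm (g x) * norm (\<phi> y)) \<partial>lborel \<partial>lborel)"
      using norm_operator_le[OF T dom]
    proof (intro nn_integral_mono_AE, eventually_elim)
      case (elim x)
      have "ennreal (norm (T \<phi> x * cnj (g x))) \<le> (\<integral>\<^sup>+y. ennreal (norm (K x y) * norm (\<phi> y)) \<partial>lborel) * ennreal (norm (g x))"
        using elim by (simp add: norm_mult ennreal_mult mult_right_mono)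
      also have "\<dots> = (\<integral>\<^sup>+y. ennreal (norm (K x y) * norm (g x) * norm (\<phi> y)) \<partial>lborel)"
        by (subst nn_integral_multc[symmetric]) (auto simp: ennreal_mult[symmetric] mult_ac)
      finally show ?case .
    qed
    also have "\<dots> = (\<integral>\<^sup>+y. \<integral>\<^sup>+x. ennreal (norm (K x y) * norm (g x) * norm (\<phi> y)) \<partial>lborel \<partial>lborel)"
      by (rule lborel_Tonelli(1)) (unfold split_beta', measurable)
    also have "\<dots> \<le> (\<integral>\<^sup>+y. S y * indicator (E n) y \<partial>lborel)"
    proof (intro nn_integral_mono)
      fix y
      have "(\<integral>\<^sup>+x. ennreal (norm (K x y) * norm (g x) * norm (\<phi> y)) \<partial>lborel) = S y * ennreal (norm (\<phi> y))"
        unfolding S_def by (subst nn_integral_multc[symmetric]) (auto simp: ennreal_mult)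
      also have "\<dots> \<le> S y * indicator (E n) y"
        by (intro mult_left_mono) (auto simp: \<phi>_def norm_mult norm_sgn indicator_def)
      finally show "(\<integral>\<^sup>+x. ennreal (norm (K x y) * norm (g x) * norm (\<phi> y)) \<partial>lborel) \<le> S y * indicator (E n) y" .
    qed
    finally have le: "(\<integral>\<^sup>+y. ennreal (norm (h y)) * indicator (E n) y \<partial>lborel) \<le> (\<integral>\<^sup>+y. S y * indicator (E n) y \<partial>lborel)" .
    have ge: "S y * indicator (E n) y \<le> ennreal (norm (h y)) * indicator (E n) y" for y
      by (auto simp: E_def indicator_def)
    have "(\<integral>\<^sup>+y. S y * indicator (E n) y \<partial>lborel) \<le> (\<integral>\<^sup>+y. ennreal (norm (h y)) * indicator (E n) y \<partial>lborel)"
      by (intro nn_integral_mono ge)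
    also have "\<dots> < \<infinity>"
      unfolding \<open>(\<integral>\<^sup>+y. ennreal (norm (h y)) * indicator (E n) y \<partial>lborel) = _\<close> hfin by simp
    finally have "(\<integral>\<^sup>+y. S y * indicator (E n) y \<partial>lborel) \<noteq> \<infinity>" by simp
    \<comment> \<open>On \<open>E n\<close> the modulus of h exceeds S pointwise, while its integral
      is at most that of S, which is finite. Hence they agree almost everywhere, and strictness on
      \<open>E n\<close> makes this set null.\<close>
    then have "AE y in lborel. ennreal (norm (h y)) * indicator (E n) y \<le> S y * indicator (E n) y"
      using nn_integral_less[of "\<lambda>y. S y * indicator (E n) y" lborel "\<lambda>y. ennreal (norm (h y)) * indicator (E n) y"] ge le
      by (auto simp: not_less[symmetric])
    then show ?thesis
      by eventually_elim (auto simp: E_def indicator_def split: if_splits)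
  qed
  have "AE y in lborel. \<forall>n. y \<notin> E n"
    using null by (simp add: AE_all_countable)
  then show ?thesis
  proof eventually_elim
    case (elim y)
    obtain n where "norm y \<le> real n" using real_arch_simple by blast
    with elim have "\<not> S y < ennreal (norm (h y))" by (auto simp: E_def)
    then show ?case by (simp add: S_def not_less)
  qed
qed

text \<open>Both factors in Hoelder's inequality are centred at y. The one with K is bounded by
  \<open>Bq\<close>; in the other, \<psi>' occurs to the first power, so \<open>swap\<close> applies
  directly and moves the centre to x, where integration in y against w produces M x.\<close>

lemma adjoint_weighted_bound:
  fixes K :: "'a::euclidean_space \<Rightarrow> 'a \<Rightarrow> complex"
  assumes T: "linear_operator_with_kernel T K"
    and adj: "adjoint_pair T g h"
    and col: "\<And>y. (\<integral>\<^sup>+x. ennreal (norm (K x y)) \<partial>lborel) \<le> ennreal c"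
    and \<psi>_meas: "(\<lambda>(x, y). \<psi> x y) \<in> borel_measurable (borel \<Otimes>\<^sub>M borel)"
    and \<psi>'_meas: "(\<lambda>(x, y). \<psi>' x y) \<in> borel_measurable (borel \<Otimes>\<^sub>M borel)"
    and \<psi>0: "\<And>x y. 0 \<le> \<psi> x y" and \<psi>'0: "\<And>x y. 0 \<le> \<psi>' x y" "\<And>x y. x \<noteq> y \<Longrightarrow> 0 < \<psi>' x y"
    and swap: "\<And>x y. \<psi>' y x \<le> Cs * \<psi> x y" and Cs: "1 \<le> Cs"
    and p: "1 < p" and B: "0 < B" and C: "0 < C"
    and Bq: "\<And>y. (\<integral>\<^sup>+x. ennreal (norm (K x y) powr conj_exp p * \<psi>' y x powr (1 - conj_exp p)) \<partial>lborel) \<le> ennreal B"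
    and w: "w \<in> borel_measurable borel" "\<And>x. 0 \<le> w x"
    and avg: "\<And>x. (\<integral>\<^sup>+y. ennreal (\<psi> x y * w y) \<partial>lborel) \<le> ennreal C * M x"
  shows "(\<integral>\<^sup>+y. ennreal (norm (h y) powr p * w y) \<partial>lborel)
    \<le> ennreal (B powr (p - 1) * Cs * C) * (\<integral>\<^sup>+x. ennreal (norm (g x) powr p) * M x \<partial>lborel)"
proof -
  note [measurable] = kernel_measurable[OF T] w(1)
  have [measurable]: "g \<in> borel_measurable borel" "h \<in> borel_measurable borel"
    using adj by (auto simp: adjoint_pair_def locally_integrable_def)
  have [measurable]: "(\<lambda>z. \<psi> (snd z) (fst z)) \<in> borel_measurable (borel \<Otimes>\<^sub>M borel)"
    using measurable_pair_swap[OF \<psi>_meas] by (simp add: split_beta')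
  have [measurable]: "\<psi> x \<in> borel_measurable borel" for x
    using measurable_compose[OF measurable_Pair1'[of x borel borel] \<psi>_meas] by simp
  have [measurable]: "(\<lambda>x. \<psi>' y x) \<in> borel_measurable borel" for y
    using measurable_compose[OF measurable_Pair1'[of y borel borel] \<psi>'_meas] by simp
  define D where "D = B powr (p - 1) * Cs"
  have D: "0 < D" using B Cs by (simp add: D_def)
  define q where "q = conj_exp p"
  define Q where "Q y x = D * (norm (g x) powr p * (\<psi> x y * w y))" for y x
  have "AE y in lborel. ennreal (norm (h y) powr p * w y) \<le> (\<integral>\<^sup>+x. ennreal (Q y x) \<partial>lborel)"
    using adjoint_kernel_bound[OF T col adj]
  proof eventually_elim
    case (elim y)
    define F G where "F x = norm (g x) powr p * \<psi>' y x" and "G x = norm (K x y) powr q * \<psi>' y x powr (1 - q)" for x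
    have [measurable]: "F \<in> borel_measurable borel" "G \<in> borel_measurable borel"
      unfolding F_def G_def by measurable
    note elim
    also have "(\<integral>\<^sup>+x. ennreal (norm (K x y) * norm (g x)) \<partial>lborel) = (\<integral>\<^sup>+x. ennreal (F x powr (1 / p) * G x powr (1 - 1 / p)) \<partial>lborel)"
    proof (intro nn_integral_cong_AE eventually_mono[OF AE_lborel_singleton[of y]])
      fix x assume "x \<noteq> y"
      then have "0 < \<psi>' y x" using \<psi>'0 by auto
      \<comment> \<open>From q (1 - 1 / p) = 1 the power of the kernel becomes 1 and the powers of
        \<psi>' cancel.\<close>
      moreover have "1 / p + (1 - q) * (1 - 1 / p) = 0" and q: "q * (1 - 1 / p) = 1"
        using p by (simp_all add: q_def conj_exp_def field_simps)
      ultimately have "\<psi>' y x powr (1 / p) * \<psi>' y x powr ((1 - q) * (1 - 1 / p)) = 1"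
        by (simp only: powr_add[symmetric]) simp
      moreover have "F x powr (1 / p) * G x powr (1 - 1 / p) =
          norm (K x y) powr (q * (1 - 1 / p)) * norm (g x) * (\<psi>' y x powr (1 / p) * \<psi>' y x powr ((1 - q) * (1 - 1 / p)))"
        using p \<open>0 < \<psi>' y x\<close> by (simp add: F_def G_def powr_mult powr_powr mult_ac)
      ultimately have "F x powr (1 / p) * G x powr (1 - 1 / p) = norm (K x y) * norm (g x)"
        unfolding q by simp
      then show "ennreal (norm (K x y) * norm (g x)) = ennreal (F x powr (1 / p) * G x powr (1 - 1 / p))"
        by simp
    qed
    finally have "ennreal (norm (h y) powr p) \<le> ennreal (B powr (p - 1)) * (\<integral>\<^sup>+x. ennreal (F x) \<partial>lborel)"
      using Bq[of y] B p \<psi>'0(1) by (intro powr_le_Holder[of F _ G]) (auto simp: F_def G_def q_def)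
    then have "ennreal (norm (h y) powr p * w y)
        \<le> ennreal (B powr (p - 1)) * (\<integral>\<^sup>+x. ennreal (F x) \<partial>lborel) * ennreal (w y)"
      using w by (simp add: ennreal_mult mult_right_mono)
    also have "\<dots> = (\<integral>\<^sup>+x. ennreal (B powr (p - 1) * F x * w y) \<partial>lborel)"
      by (simp add: ennreal_mult w nn_integral_cmult nn_integral_multc F_def \<psi>'0(1))
    also have "\<dots> \<le> (\<integral>\<^sup>+x. ennreal (Q y x) \<partial>lborel)"
    proof (intro nn_integral_mono ennreal_leI)
      fix x
      have "B powr (p - 1) * F x * w y = B powr (p - 1) * norm (g x) powr p * w y * \<psi>' y x"
        by (simp add: F_def mult_ac)
      also have "\<dots> \<le> B powr (p - 1) * norm (g x) powr p * w y * (Cs * \<psi> x y)"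
        using w by (intro mult_left_mono swap) auto
      also have "\<dots> = Q y x" by (simp add: Q_def D_def mult_ac)
      finally show "B powr (p - 1) * F x * w y \<le> Q y x" .
    qed
    finally show ?case .
  qed
  then have "(\<integral>\<^sup>+y. ennreal (norm (h y) powr p * w y) \<partial>lborel) \<le> (\<integral>\<^sup>+y. \<integral>\<^sup>+x. ennreal (Q y x) \<partial>lborel \<partial>lborel)"
    by (rule nn_integral_mono_AE)
  also have Qm: "(\<lambda>(y, x). ennreal (Q y x)) \<in> borel_measurable (borel \<Otimes>\<^sub>M borel)"
    unfolding Q_def split_beta' by measurable
  have "(\<integral>\<^sup>+y. \<integral>\<^sup>+x. ennreal (Q y x) \<partial>lborel \<partial>lborel) = (\<integral>\<^sup>+x. \<integral>\<^sup>+y. ennreal (Q y x) \<partial>lborel \<partial>lborel)"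
    by (rule lborel_Tonelli(1)[OF Qm])
  also have "\<dots> \<le> ennreal (D * C) * (\<integral>\<^sup>+x. ennreal (norm (g x) powr p) * M x \<partial>lborel)"
  proof (rule nn_integral_le_cmult)
    show "(\<lambda>x. \<integral>\<^sup>+y. ennreal (Q y x) \<partial>lborel) \<in> borel_measurable lborel"
      using lborel_Tonelli(2)[OF Qm] by simp
    show "0 < D * C" using D C by simp
    fix x
    have "(\<integral>\<^sup>+y. ennreal (Q y x) \<partial>lborel) = ennreal (D * norm (g x) powr p) * (\<integral>\<^sup>+y. ennreal (\<psi> x y * w y) \<partial>lborel)"
      using D w \<psi>0 by (subst nn_integral_cmult[symmetric]) (auto simp: Q_def ennreal_mult[symmetric] mult_ac)
    also have "\<dots> \<le> ennreal (D * norm (g x) powr p) * (ennreal C * M x)"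
      by (intro mult_left_mono avg) auto
    also have "\<dots> = ennreal (D * C) * (ennreal (norm (g x) powr p) * M x)"
      using D C by (simp add: ennreal_mult mult_ac)
    finally show "(\<integral>\<^sup>+y. ennreal (Q y x) \<partial>lborel) \<le> ennreal (D * C) * (ennreal (norm (g x) powr p) * M x)" .
  qed
  finally show ?thesis by (simp add: D_def)
qed

text \<open>The identity (1 + 1 / t)^(-\<delta>) = t^\<delta> (1 + t)^(-\<delta>) with t = R /
  \<sigma> y gives the form of \<open>decay\<close>. Passing from \<rho> to the larger \<sigma>
  costs L^\<delta> in the first factor, whereas it only enlarges the second.\<close>

lemma kernel_condition_majorant:
  fixes \<rho> \<sigma> :: "'a::euclidean_space \<Rightarrow> real"
  assumes \<rho>: "\<And>x. 0 < \<rho> x" and L: "1 \<le> L" and \<sigma>: "\<And>x. \<rho> x \<le> \<sigma> x" "\<And>x. \<sigma> x \<le> L * \<rho> x"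
    and \<delta>: "0 < \<delta>" and N: "0 < N" and R: "0 < R"
  shows "(1 + \<rho> y / R) powr (- \<delta>) * (1 + R / \<rho> y) powr (- N) \<le> L powr \<delta> * decay \<delta> N (R / \<sigma> y)"
proof -
  have spos: "0 < \<sigma> y" using \<rho>[of y] \<sigma>(1)[of y] by linarith
  have "(1 + \<rho> y / R) powr (- \<delta>) \<le> ((1 + \<sigma> y / R) / L) powr (- \<delta>)"
  proof (intro powr_mono2')
    have "1 + \<sigma> y / R \<le> L + L * \<rho> y / R"
      using \<sigma>(2)[of y] R L by (intro add_mono divide_right_mono) auto
    then show "(1 + \<sigma> y / R) / L \<le> 1 + \<rho> y / R"
      using L by (simp add: field_simps)
    show "0 < (1 + \<sigma> y / R) / L"
      using spos R L by (simp add: add_pos_pos)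
  qed (use \<delta> in simp)
  also have "\<dots> = L powr \<delta> * (1 + \<sigma> y / R) powr (- \<delta>)"
    using L spos R by (simp add: powr_divide powr_minus[of L] divide_inverse[of _ "inverse _"] mult.commute)
  also have "(1 + \<sigma> y / R) powr (- \<delta>) = (R / \<sigma> y) powr \<delta> * (1 + R / \<sigma> y) powr (- \<delta>)"
  proof -
    have "1 + \<sigma> y / R = (1 + R / \<sigma> y) / (R / \<sigma> y)"
      using spos R by (simp add: field_simps)
    then have "(1 + \<sigma> y / R) powr (- \<delta>) = (1 + R / \<sigma> y) powr (- \<delta>) / (R / \<sigma> y) powr (- \<delta>)"
      using spos R by (simp add: powr_divide del: divide_divide_eq_right)
    then show ?thesis
      unfolding powr_minus[of "R / \<sigma> y" \<delta>] by (simp add: divide_inverse[of _ "inverse _"] mult.commute)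
  qed
  finally have 1: "(1 + \<rho> y / R) powr (- \<delta>) \<le> L powr \<delta> * ((R / \<sigma> y) powr \<delta> * (1 + R / \<sigma> y) powr (- \<delta>))" .
  have 2: "(1 + R / \<rho> y) powr (- N) \<le> (1 + R / \<sigma> y) powr (- N)"
    using \<rho>[of y] \<sigma>(1)[of y] spos R N
    by (intro powr_mono2' add_left_mono divide_left_mono) (auto simp: add_pos_pos)
  have "(1 + \<rho> y / R) powr (- \<delta>) * (1 + R / \<rho> y) powr (- N)
      \<le> (L powr \<delta> * ((R / \<sigma> y) powr \<delta> * (1 + R / \<sigma> y) powr (- \<delta>))) * (1 + R / \<sigma> y) powr (- N)"
    using 1 2 by (intro mult_mono) auto
  also have "\<dots> = L powr \<delta> * ((R / \<sigma> y) powr \<delta> * ((1 + R / \<sigma> y) powr (- \<delta>) * (1 + R / \<sigma> y) powr (- N)))"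
    by (simp only: mult_ac)
  also have "(1 + R / \<sigma> y) powr (- \<delta>) * (1 + R / \<sigma> y) powr (- N) = (1 + R / \<sigma> y) powr (- (\<delta> + N))"
    by (simp add: powr_add[symmetric])
  finally show ?thesis by (simp add: decay_def)
qed

theorem theorem5:
  fixes \<rho> :: "'a::euclidean_space \<Rightarrow> real"
    and T Tstar :: "('a \<Rightarrow> complex) \<Rightarrow> 'a \<Rightarrow> complex"
    and K :: "'a \<Rightarrow> 'a \<Rightarrow> complex"
    and s \<delta> :: real
  assumes "critical_radius_function \<rho>"
    and "linear_operator_with_kernel T K"
    and "is_adjoint T Tstar"
    and "1 < s" and "0 < \<delta>"
    and "\<forall>N>0. \<exists>C::real. \<forall>x0 y R. 0 < R \<and> dist y x0 < R / 2 \<longrightarrow>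
           ennreal_powr
             (\<integral>\<^sup>+x\<in>{x. R < dist x0 x \<and> dist x0 x < 2 * R}.
                ennreal (norm (K x y) powr s) \<partial>lborel) (1 / s)
           \<le> ennreal (C * R powr (- (real DIM('a) / conj_exp s)) *
                (1 + \<rho> x0 / R) powr (- \<delta>) * (1 + R / \<rho> x0) powr (- N))"
  shows "\<forall>\<theta>\<ge>0.
    (\<exists>C>0. \<forall>p w f. 1 \<le> p \<and> p < s \<and> weight w \<and> f \<in> kernel_domain K \<longrightarrow>
       (\<integral>\<^sup>+x. ennreal (norm (T f x) powr p * w x) \<partial>lborel)
       \<le> ennreal C * (\<integral>\<^sup>+x. ennreal (norm (f x) powr p) *
                            maximal_function \<rho> \<theta> (conj_exp (s / p)) w x \<partial>lborel)) \<and>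
    (\<forall>p>conj_exp s. \<exists>C>0. \<forall>w f. weight w \<and> f \<in> adjoint_domain T \<longrightarrow>
       (\<integral>\<^sup>+x. ennreal (norm (Tstar f x) powr p * w x) \<partial>lborel)
       \<le> ennreal C * (\<integral>\<^sup>+x. ennreal (norm (f x) powr p) *
                            maximal_function \<rho> \<theta> 1 w x \<partial>lborel))"
proof (intro allI impI)
  fix \<theta> :: real assume \<theta>: "0 \<le> \<theta>"
  note T = assms(2) and s = assms(4) and \<delta> = assms(5) and hyp = assms(6)
  have \<rho>: "\<And>x. 0 < \<rho> x" using assms(1) by (simp add: critical_radius_function_def)
  obtain \<sigma> L where [measurable]: "\<sigma> \<in> borel_measurable borel" and L: "1 \<le> L"
    and \<sigma>: "\<And>x. \<rho> x \<le> \<sigma> x" "\<And>x. \<sigma> x \<le> L * \<rho> x"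
    by (rule critical_radius_majorant[OF assms(1)]) (rule that)
  have spos: "0 < \<sigma> x" for x using \<rho>[of x] \<sigma>(1)[of x] by linarith
  \<comment> \<open>The rate \<theta> + 1 exceeds \<theta>, as averaging against \<psi> demands.
    Swapping the centre then determines \<open>b1\<close>, and \<open>b1\<close> determines the
    order N at which the kernel condition is used.\<close>
  have b: "0 < \<theta> + 1" "\<theta> < \<theta> + 1" using \<theta> by auto
  obtain b1 Cs where b1: "0 < b1" and Cs: "1 \<le> Cs"
    and swap: "\<And>x y. radial_kernel \<sigma> \<delta> b1 y x \<le> Cs * radial_kernel \<sigma> \<delta> (\<theta> + 1) x y"
    by (rule radial_kernel_swap[OF assms(1) L \<sigma> \<delta> b(1)]) (rule that)
  obtain Ca where Ca: "0 < Ca" and avg: "\<And>w x. w \<in> borel_measurable borel \<Longrightarrow> \<forall>y. 0 \<le> w y \<Longrightarrow>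
      (\<integral>\<^sup>+y. ennreal (radial_kernel \<sigma> \<delta> (\<theta> + 1) x y * w y) \<partial>lborel) \<le> ennreal Ca * maximal_function \<rho> \<theta> 1 w x"
    by (rule radial_kernel_average[of \<rho> L \<sigma>, OF \<rho> L \<sigma> \<theta> \<delta> b(2)]) (rule that)
  define N where "N = b1 + \<theta> + 1"
  have N: "0 < N" using b1 \<theta> by (simp add: N_def)
  obtain C0 where C0: "\<And>x0 y R. 0 < R \<Longrightarrow> dist y x0 < R / 2 \<Longrightarrow>
           ennreal_powr (\<integral>\<^sup>+x\<in>annulus x0 R. ennreal (norm (K x y) powr s) \<partial>lborel) (1 / s)
           \<le> ennreal (C0 * R powr (- (real DIM('a) / conj_exp s)) *
                (1 + \<rho> x0 / R) powr (- \<delta>) * (1 + R / \<rho> x0) powr (- N))"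
    using hyp N unfolding annulus_def by blast
  \<comment> \<open>The constant C0 carries no sign information, hence the maximum with 1; the power
    of L pays for replacing \<rho> by \<sigma>.\<close>
  define D where "D = max 1 C0 * L powr \<delta>"
  have "1 \<le> L powr \<delta>" using L \<delta> by (simp add: ge_one_powr_ge_zero)
  then have D: "1 \<le> D" unfolding D_def using mult_mono[of 1 "max 1 C0" 1 "L powr \<delta>"] by simp
  have hyp': "ennreal_powr (\<integral>\<^sup>+x\<in>annulus y R. ennreal (norm (K x y) powr s) \<partial>lborel) (1 / s)
      \<le> ennreal (D * R powr (- (real DIM('a) / conj_exp s)) * decay \<delta> (b1 + \<theta> + 1) (R / \<sigma> y))"
    if R: "0 < R" for y R
  proof -
    let ?e = "R powr (- (real DIM('a) / conj_exp s))"
    let ?u = "(1 + \<rho> y / R) powr (- \<delta>) * (1 + R / \<rho> y) powr (- N)"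
    \<comment> \<open>Choosing the centre x0 = y makes dist y x0 = 0, which is below R / 2.\<close>
    note C0[OF R, of y y]
    also have "C0 * ?e * (1 + \<rho> y / R) powr (- \<delta>) * (1 + R / \<rho> y) powr (- N) \<le> max 1 C0 * (?e * ?u)"
      by (simp only: mult.assoc) (intro mult_right_mono, auto)
    also have "\<dots> \<le> max 1 C0 * (?e * (L powr \<delta> * decay \<delta> N (R / \<sigma> y)))"
      by (intro mult_left_mono kernel_condition_majorant[of \<rho> L \<sigma>, OF \<rho> L \<sigma> \<delta> N R]) auto
    also have "\<dots> = D * ?e * decay \<delta> (b1 + \<theta> + 1) (R / \<sigma> y)"
      by (simp add: D_def N_def mult_ac)
    finally show ?thesis using R by (simp add: ennreal_leI)
  qed
  have kmeas: "(\<lambda>x. norm (K x y)) \<in> borel_measurable borel" for y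
    using kernel_measurable(2)[OF T, of y] by measurable
  obtain Cw where Cw: "0 < Cw" and inner: "\<And>p w y. \<lbrakk>1 \<le> p; p < s; w \<in> borel_measurable borel; \<forall>x. 0 \<le> w x\<rbrakk> \<Longrightarrow>
      (\<integral>\<^sup>+x. ennreal (norm (K x y) powr p * radial_kernel \<sigma> \<delta> b1 y x powr (1 - p) * w x) \<partial>lborel)
      \<le> ennreal Cw * maximal_function \<rho> \<theta> (conj_exp (s / p)) w y"
    by (rule weighted_kernel_bound[of \<rho> L \<sigma>, OF \<rho> L \<sigma> \<theta> \<delta> less_imp_le[OF b1] s D norm_ge_zero kmeas hyp'])
      (assumption, rule that)
  have le_const: "ennreal C * maximal_function \<rho> \<theta> r (\<lambda>_. 1) y \<le> ennreal C" for C r y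
    using mult_left_mono[OF maximal_function_one_le[of \<rho>, OF \<rho> \<theta>], of "ennreal C"] by simp
  have inner1: "(\<integral>\<^sup>+x. ennreal (norm (K x y) powr p * radial_kernel \<sigma> \<delta> b1 y x powr (1 - p)) \<partial>lborel) \<le> ennreal Cw"
    if "1 \<le> p" "p < s" for p y
    using order_trans[OF inner[OF that, of "\<lambda>_. 1" y] le_const] by simp
  have col: "(\<integral>\<^sup>+x. ennreal (norm (K x y)) \<partial>lborel) \<le> ennreal Cw" for y
  proof -
    have "(\<integral>\<^sup>+x. ennreal (norm (K x y)) \<partial>lborel) =
        (\<integral>\<^sup>+x. ennreal (norm (K x y) powr 1 * radial_kernel \<sigma> \<delta> b1 y x powr (1 - 1)) \<partial>lborel)"
    \<comment> \<open>The case p = 1 and w = 1. At x = y the radial kernel is 0 and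
      \<open>0 powr 0 = 0\<close>, so equality is claimed only off that point.\<close>
    proof (intro nn_integral_cong_AE eventually_mono[OF AE_lborel_singleton[of y]])
      fix x assume "x \<noteq> y"
      then have "0 < radial_kernel \<sigma> \<delta> b1 y x"
        by (intro radial_kernel_pos spos) auto
      then show "ennreal (norm (K x y)) = ennreal (norm (K x y) powr 1 * radial_kernel \<sigma> \<delta> b1 y x powr (1 - 1))"
        by simp
    qed
    also have "\<dots> \<le> ennreal Cw" using s by (intro inner1) auto
    finally show ?thesis .
  qed
  define A where "A = max 1 Ca"
  have A: "1 \<le> A" by (simp add: A_def)
  have int\<psi>: "(\<integral>\<^sup>+y. ennreal (radial_kernel \<sigma> \<delta> (\<theta> + 1) x y) \<partial>lborel) \<le> ennreal A" for x
  proof -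
    have "(\<integral>\<^sup>+y. ennreal (radial_kernel \<sigma> \<delta> (\<theta> + 1) x y) \<partial>lborel) \<le> ennreal Ca"
      using order_trans[OF avg[of "\<lambda>_. 1" x] le_const] by simp
    also have "\<dots> \<le> ennreal A" by (intro ennreal_leI) (simp add: A_def)
    finally show ?thesis .
  qed
  have meas: "(\<lambda>(x, y). radial_kernel \<sigma> \<delta> b x y) \<in> borel_measurable (borel \<Otimes>\<^sub>M borel)" for b
    by (rule radial_kernel_measurable) measurable
  have pos: "x \<noteq> y \<Longrightarrow> 0 < radial_kernel \<sigma> \<delta> b1 x y" for x y
    by (rule radial_kernel_pos[of \<sigma>, OF spos])
  have weightD: "w \<in> borel_measurable borel" "0 \<le> w x" "\<forall>x. 0 \<le> w x" if "weight w" for w :: "'a \<Rightarrow> real" and x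
    using that by (auto simp: weight_def locally_integrable_def)
  show "(\<exists>C>0. \<forall>p w f. 1 \<le> p \<and> p < s \<and> weight w \<and> f \<in> kernel_domain K \<longrightarrow>
       (\<integral>\<^sup>+x. ennreal (norm (T f x) powr p * w x) \<partial>lborel)
       \<le> ennreal C * (\<integral>\<^sup>+x. ennreal (norm (f x) powr p) *
                            maximal_function \<rho> \<theta> (conj_exp (s / p)) w x \<partial>lborel)) \<and>
    (\<forall>p>conj_exp s. \<exists>C>0. \<forall>w f. weight w \<and> f \<in> adjoint_domain T \<longrightarrow>
       (\<integral>\<^sup>+x. ennreal (norm (Tstar f x) powr p * w x) \<partial>lborel)
       \<le> ennreal C * (\<integral>\<^sup>+x. ennreal (norm (f x) powr p) *
                            maximal_function \<rho> \<theta> 1 w x \<partial>lborel))"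
  proof
    show "\<exists>C>0. \<forall>p w f. 1 \<le> p \<and> p < s \<and> weight w \<and> f \<in> kernel_domain K \<longrightarrow>
       (\<integral>\<^sup>+x. ennreal (norm (T f x) powr p * w x) \<partial>lborel)
       \<le> ennreal C * (\<integral>\<^sup>+x. ennreal (norm (f x) powr p) *
                            maximal_function \<rho> \<theta> (conj_exp (s / p)) w x \<partial>lborel)"
    \<comment> \<open>The witness is free of p: all dependence on p was absorbed by the exponent s
      and by the uniformity of Cw.\<close>
    proof (intro exI[of _ "(A * Cs) powr s * Cw"] conjI allI impI)
      show "0 < (A * Cs) powr s * Cw" using A Cs Cw by simp
      fix p :: real and w :: "'a \<Rightarrow> real" and f :: "'a \<Rightarrow> complex" assume *: "1 \<le> p \<and> p < s \<and> weight w \<and> f \<in> kernel_domain K"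
      then have p: "1 \<le> p" "p < s" and w: "weight w" and f: "f \<in> kernel_domain K" by auto
      show "(\<integral>\<^sup>+x. ennreal (norm (T f x) powr p * w x) \<partial>lborel)
         \<le> ennreal ((A * Cs) powr s * Cw) * (\<integral>\<^sup>+x. ennreal (norm (f x) powr p) *
                              maximal_function \<rho> \<theta> (conj_exp (s / p)) w x \<partial>lborel)"
        by (rule operator_weighted_bound[OF T meas meas radial_kernel_nonneg pos swap Cs int\<psi> A Cw p
              weightD(1,2)[OF w] f inner[OF p weightD(1,3)[OF w]]])
    qed
  next
    show "\<forall>p>conj_exp s. \<exists>C>0. \<forall>w f. weight w \<and> f \<in> adjoint_domain T \<longrightarrow>
       (\<integral>\<^sup>+x. ennreal (norm (Tstar f x) powr p * w x) \<partial>lborel)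
       \<le> ennreal C * (\<integral>\<^sup>+x. ennreal (norm (f x) powr p) *
                            maximal_function \<rho> \<theta> 1 w x \<partial>lborel)"
    proof (intro allI impI)
      fix p assume p: "conj_exp s < p"
      have "1 < conj_exp s"
        using s by (simp add: conj_exp_def field_simps)
      with p have p1: "1 < p" by simp
      \<comment> \<open>Conjugation reverses the order, so p > s' becomes p' < s, the range in which
        the unweighted kernel bound holds.\<close>
      have q: "1 \<le> conj_exp p" "conj_exp p < s"
        using p p1 s by (auto simp: conj_exp_def field_simps)
      show "\<exists>C>0. \<forall>w f. weight w \<and> f \<in> adjoint_domain T \<longrightarrow>
         (\<integral>\<^sup>+x. ennreal (norm (Tstar f x) powr p * w x) \<partial>lborel)
         \<le> ennreal C * (\<integral>\<^sup>+x. ennreal (norm (f x) powr p) * maximal_function \<rho> \<theta> 1 w x \<partial>lborel)"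
      \<comment> \<open>Here p ranges over an unbounded interval and enters through
        \<open>Cw powr (p - 1)\<close>, so the constant is chosen after p.\<close>
      proof (intro exI[of _ "Cw powr (p - 1) * Cs * Ca"] conjI allI impI)
        show "0 < Cw powr (p - 1) * Cs * Ca" using Cw Cs Ca by simp
        fix w :: "'a \<Rightarrow> real" and f :: "'a \<Rightarrow> complex" assume "weight w \<and> f \<in> adjoint_domain T"
        then have w: "weight w" and adj: "adjoint_pair T f (Tstar f)"
          using assms(3) by (auto simp: is_adjoint_def)
        show "(\<integral>\<^sup>+x. ennreal (norm (Tstar f x) powr p * w x) \<partial>lborel)
           \<le> ennreal (Cw powr (p - 1) * Cs * Ca) *
              (\<integral>\<^sup>+x. ennreal (norm (f x) powr p) * maximal_function \<rho> \<theta> 1 w x \<partial>lborel)"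
          by (rule adjoint_weighted_bound[OF T adj col meas meas radial_kernel_nonneg radial_kernel_nonneg pos
                swap Cs p1 Cw Ca inner1[OF q] weightD(1,2)[OF w] avg[OF weightD(1,3)[OF w]]])
      qed
    qed
  qed
qed

end
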